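(* Let $\Lambda$ be an artin algebra, $\Gamma=\begin{pmatrix}\Lambda&0\\ \Lambda&\Lambda\end{pmatrix}$, and let $$0\to(N_1,N_2,g)\xrightarrow{(j_1,\,j_2)}(E_1,E_2,h)\xrightarrow{(p_1,\,p_2)}(M_1,M_2,f)\to0$$ be an almost split sequence of $\Gamma$-modules such that each of $g$ and $f$ is neither a splittable epimorphism nor a splittable monomorphism. Put $N_0=\ker g$, $E_0=\ker h$, $M_0=\ker f$, $N_3=\mathrm{Coker}\,g$, $E_3=\mathrm{Coker}\,h$, $M_3=\mathrm{Coker}\,f$, and let $j_0:N_0\to E_0$, $p_0:E_0\to M_0$, $j_3:N_3\to E_3$, $p_3:E_3\to M_3$ be the induced maps. Then $p_0$ is an epimorphism, $j_3$ is a monomorphism, and for each $0\le i\le3$ the exact sequence $$0\to N_i\xrightarrow{j_i}E_i\xrightarrow{p_i}M_i\to0$$ splits.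
   Context: Modules are finitely generated left modules. The category of finitely generated $\Gamma$-modules is identified with the category $\mathrm{maps}(\mathrm{mod}\,\Lambda)$ whose objects are triples $(M_1,M_2,f)$ with $f:M_1\to M_2$ a map of finitely generated $\Lambda$-modules, and whose morphisms $(M_1,M_2,f)\to(M_1',M_2',f')$ are pairs $(a_1,a_2)$ with $a_i:M_i\to M_i'$ and $f'a_1=a_2f$. *)

theory Defs
  imports "HOL-Algebra.Module" "HOL-Algebra.RingHom"
begin

section \<open>Artin algebras\<close>

locale artinian_cring = cring R for R (structure) +
  assumes descending_chain:
    "\<lbrakk>\<And>n::nat. ideal (I n) R; \<And>n. I (Suc n) \<subseteq> I n\<rbrakk> \<Longrightarrow> \<exists>n. \<forall>m\<ge>n. I m = I n"

text \<open>The structure map \<open>\<phi>\<close> is a ring homomorphism from \<open>R\<close> into the center of \<open>L\<close>.\<close>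

locale artin_algebra = R?: artinian_cring R + L?: ring L
  for R (structure) and \<phi> and L (structure) +
  assumes structure_map: "\<phi> \<in> ring_hom R L"
    and central: "\<lbrakk>r \<in> carrier R; x \<in> carrier L\<rbrakk> \<Longrightarrow> \<phi> r \<otimes>\<^bsub>L\<^esub> x = x \<otimes>\<^bsub>L\<^esub> \<phi> r"
    and finitely_generated:
      "\<exists>S. finite S \<and> S \<subseteq> carrier L \<and>
         (\<forall>x \<in> carrier L. \<exists>a \<in> S \<rightarrow> carrier R. x = (\<Oplus>\<^bsub>L\<^esub>s \<in> S. \<phi> (a s) \<otimes>\<^bsub>L\<^esub> s))"

section \<open>Finitely generated left modules over a ring\<close>

text \<open>The locale \<^locale>\<open>module\<close> requires a commutative ring of scalars; these are the same
  axioms over an arbitrary ring. As there, the fields \<open>mult\<close> and \<open>one\<close> of the record of a module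
  play no role.\<close>

locale left_module = R?: ring R + M?: abelian_group M
  for R (structure) and M :: "('a, 'b, 'c) module_scheme" (structure) +
  assumes smult_closed:
      "\<lbrakk>a \<in> carrier R; x \<in> carrier M\<rbrakk> \<Longrightarrow> a \<odot>\<^bsub>M\<^esub> x \<in> carrier M"
    and smult_l_distr:
      "\<lbrakk>a \<in> carrier R; b \<in> carrier R; x \<in> carrier M\<rbrakk> \<Longrightarrow>
       (a \<oplus>\<^bsub>R\<^esub> b) \<odot>\<^bsub>M\<^esub> x = a \<odot>\<^bsub>M\<^esub> x \<oplus>\<^bsub>M\<^esub> b \<odot>\<^bsub>M\<^esub> x"
    and smult_r_distr:
      "\<lbrakk>a \<in> carrier R; x \<in> carrier M; y \<in> carrier M\<rbrakk> \<Longrightarrow>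
       a \<odot>\<^bsub>M\<^esub> (x \<oplus>\<^bsub>M\<^esub> y) = a \<odot>\<^bsub>M\<^esub> x \<oplus>\<^bsub>M\<^esub> a \<odot>\<^bsub>M\<^esub> y"
    and smult_assoc1:
      "\<lbrakk>a \<in> carrier R; b \<in> carrier R; x \<in> carrier M\<rbrakk> \<Longrightarrow>
       (a \<otimes>\<^bsub>R\<^esub> b) \<odot>\<^bsub>M\<^esub> x = a \<odot>\<^bsub>M\<^esub> (b \<odot>\<^bsub>M\<^esub> x)"
    and smult_one: "x \<in> carrier M \<Longrightarrow> \<one>\<^bsub>R\<^esub> \<odot>\<^bsub>M\<^esub> x = x"

locale fg_module = left_module +
  assumes finitely_generated:
    "\<exists>S. finite S \<and> S \<subseteq> carrier M \<and>
       (\<forall>x \<in> carrier M. \<exists>a \<in> S \<rightarrow> carrier R. x = (\<Oplus>\<^bsub>M\<^esub>s \<in> S. a s \<odot>\<^bsub>M\<^esub> s))"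

definition lmod_hom ::
  "('r, 'x) ring_scheme \<Rightarrow> ('r, 'a) module \<Rightarrow> ('r, 'b) module \<Rightarrow> ('a \<Rightarrow> 'b) set" where
  "lmod_hom R M N = {f \<in> carrier M \<rightarrow> carrier N.
     (\<forall>x \<in> carrier M. \<forall>y \<in> carrier M. f (x \<oplus>\<^bsub>M\<^esub> y) = f x \<oplus>\<^bsub>N\<^esub> f y) \<and>
     (\<forall>r \<in> carrier R. \<forall>x \<in> carrier M. f (r \<odot>\<^bsub>M\<^esub> x) = r \<odot>\<^bsub>N\<^esub> f x)}"

definition splittable_epi ::
  "('r, 'x) ring_scheme \<Rightarrow> ('r, 'a) module \<Rightarrow> ('r, 'b) module \<Rightarrow> ('a \<Rightarrow> 'b) \<Rightarrow> bool" where
  "splittable_epi R M N f \<longleftrightarrow> f \<in> lmod_hom R M N \<and>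
     (\<exists>s \<in> lmod_hom R N M. \<forall>y \<in> carrier N. f (s y) = y)"

definition splittable_mono ::
  "('r, 'x) ring_scheme \<Rightarrow> ('r, 'a) module \<Rightarrow> ('r, 'b) module \<Rightarrow> ('a \<Rightarrow> 'b) \<Rightarrow> bool" where
  "splittable_mono R M N f \<longleftrightarrow> f \<in> lmod_hom R M N \<and>
     (\<exists>t \<in> lmod_hom R N M. \<forall>x \<in> carrier M. t (f x) = x)"

definition short_exact ::
  "('r, 'x) ring_scheme \<Rightarrow> ('r, 'a) module \<Rightarrow> ('a \<Rightarrow> 'b) \<Rightarrow> ('r, 'b) module \<Rightarrow> ('b \<Rightarrow> 'c) \<Rightarrow>
   ('r, 'c) module \<Rightarrow> bool" where
  "short_exact R A j B p C \<longleftrightarrow>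
     fg_module R A \<and> fg_module R B \<and> fg_module R C \<and>
     j \<in> lmod_hom R A B \<and> p \<in> lmod_hom R B C \<and>
     inj_on j (carrier A) \<and> j ` carrier A = a_kernel B C p \<and> p ` carrier B = carrier C"

definition split_short_exact ::
  "('r, 'x) ring_scheme \<Rightarrow> ('r, 'a) module \<Rightarrow> ('a \<Rightarrow> 'b) \<Rightarrow> ('r, 'b) module \<Rightarrow> ('b \<Rightarrow> 'c) \<Rightarrow>
   ('r, 'c) module \<Rightarrow> bool" where
  "split_short_exact R A j B p C \<longleftrightarrow> short_exact R A j B p C \<and> splittable_epi R B C p"

section \<open>Kernels and cokernels\<close>

definition ker_module ::
  "('r, 'a) module \<Rightarrow> ('r, 'b) module \<Rightarrow> ('a \<Rightarrow> 'b) \<Rightarrow> ('r, 'a) module" where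
  "ker_module M N f = M\<lparr>carrier := a_kernel M N f\<rparr>"

definition quotient_module :: "('r, 'a) module \<Rightarrow> 'a set \<Rightarrow> ('r, 'a set) module" where
  "quotient_module M K =
     \<lparr>carrier = a_rcosets\<^bsub>M\<^esub> K, mult = undefined, one = undefined,
      zero = K, add = set_add M,
      smult = \<lambda>r C. \<Union>x \<in> C. K +>\<^bsub>M\<^esub> (r \<odot>\<^bsub>M\<^esub> x)\<rparr>"

definition coker_module ::
  "('r, 'a) module \<Rightarrow> ('r, 'b) module \<Rightarrow> ('a \<Rightarrow> 'b) \<Rightarrow> ('r, 'b set) module" where
  "coker_module M N f = quotient_module N (f ` carrier M)"

text \<open>For \<open>f : M \<rightarrow> N\<close>, \<open>f' : M' \<rightarrow> N'\<close> and \<open>u : N \<rightarrow> N'\<close> mapping the image of \<open>f\<close> into the image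
  of \<open>f'\<close>, \<open>coker_map M' N' f' u\<close> is the induced map \<open>Coker f \<rightarrow> Coker f'\<close> sending the coset of
  \<open>x\<close> to the coset of \<open>u x\<close>.\<close>

definition coker_map ::
  "('r, 'a) module \<Rightarrow> ('r, 'b) module \<Rightarrow> ('a \<Rightarrow> 'b) \<Rightarrow> ('c \<Rightarrow> 'b) \<Rightarrow> 'c set \<Rightarrow> 'b set" where
  "coker_map M' N' f' u C = (\<Union>x \<in> C. (f' ` carrier M') +>\<^bsub>N'\<^esub> u x)"

section \<open>Almost split sequences\<close>

text \<open>The test modules \<open>X\<close> below range over modules whose elements are sets of functions from
  \<open>nat\<close> to the type of ring elements. This is no restriction: a finitely generated left
  \<open>R\<close>-module is isomorphic to a quotient of some \<open>R\<^sup>n\<close>, the elements of which are cosets in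
  a set of functions of this kind. So every isomorphism class of finitely generated modules
  is represented.\<close>

definition right_almost_split ::
  "('r, 'x) ring_scheme \<Rightarrow> ('r, 'b) module \<Rightarrow> ('b \<Rightarrow> 'c) \<Rightarrow> ('r, 'c) module \<Rightarrow> bool" where
  "right_almost_split R B p C \<longleftrightarrow>
     p \<in> lmod_hom R B C \<and> \<not> splittable_epi R B C p \<and>
     (\<forall>(X :: ('r, (nat \<Rightarrow> 'r) set) module) u.
        fg_module R X \<and> u \<in> lmod_hom R X C \<and> \<not> splittable_epi R X C u \<longrightarrow>
        (\<exists>v \<in> lmod_hom R X B. \<forall>x \<in> carrier X. p (v x) = u x))"

definition left_almost_split ::
  "('r, 'x) ring_scheme \<Rightarrow> ('r, 'a) module \<Rightarrow> ('a \<Rightarrow> 'b) \<Rightarrow> ('r, 'b) module \<Rightarrow> bool" where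
  "left_almost_split R A j B \<longleftrightarrow>
     j \<in> lmod_hom R A B \<and> \<not> splittable_mono R A B j \<and>
     (\<forall>(X :: ('r, (nat \<Rightarrow> 'r) set) module) u.
        fg_module R X \<and> u \<in> lmod_hom R A X \<and> \<not> splittable_mono R A X u \<longrightarrow>
        (\<exists>v \<in> lmod_hom R B X. \<forall>x \<in> carrier A. v (j x) = u x))"

definition almost_split_sequence ::
  "('r, 'x) ring_scheme \<Rightarrow> ('r, 'a) module \<Rightarrow> ('a \<Rightarrow> 'b) \<Rightarrow> ('r, 'b) module \<Rightarrow> ('b \<Rightarrow> 'c) \<Rightarrow>
   ('r, 'c) module \<Rightarrow> bool" where
  "almost_split_sequence R A j B p C \<longleftrightarrow>
     short_exact R A j B p C \<and> left_almost_split R A j B \<and> right_almost_split R B p C"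

section \<open>The triangular matrix ring and its modules\<close>

text \<open>The triple \<open>(a, b, c)\<close> stands for the lower triangular matrix with rows \<open>(a, 0)\<close>
  and \<open>(b, c)\<close>.\<close>

definition tri_ring :: "('r, 'x) ring_scheme \<Rightarrow> ('r \<times> 'r \<times> 'r) ring" where
  "tri_ring L =
     \<lparr>carrier = carrier L \<times> carrier L \<times> carrier L,
      mult = (\<lambda>(a, b, c) (a', b', c').
        (a \<otimes>\<^bsub>L\<^esub> a', b \<otimes>\<^bsub>L\<^esub> a' \<oplus>\<^bsub>L\<^esub> c \<otimes>\<^bsub>L\<^esub> b', c \<otimes>\<^bsub>L\<^esub> c')),
      one = (\<one>\<^bsub>L\<^esub>, \<zero>\<^bsub>L\<^esub>, \<one>\<^bsub>L\<^esub>),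
      zero = (\<zero>\<^bsub>L\<^esub>, \<zero>\<^bsub>L\<^esub>, \<zero>\<^bsub>L\<^esub>),
      add = (\<lambda>(a, b, c) (a', b', c'). (a \<oplus>\<^bsub>L\<^esub> a', b \<oplus>\<^bsub>L\<^esub> b', c \<oplus>\<^bsub>L\<^esub> c'))\<rparr>"

text \<open>The module over the triangular matrix ring that corresponds to the object
  \<open>(M\<^sub>1, M\<^sub>2, f)\<close> of the category of maps: a matrix acts on the column \<open>(x, y)\<close>, with \<open>f\<close> used
  to move \<open>x\<close> to \<open>M\<^sub>2\<close>.\<close>

definition tri_module ::
  "('r, 'a) module \<Rightarrow> ('r, 'b) module \<Rightarrow> ('a \<Rightarrow> 'b) \<Rightarrow> ('r \<times> 'r \<times> 'r, 'a \<times> 'b) module" where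
  "tri_module M1 M2 f =
     \<lparr>carrier = carrier M1 \<times> carrier M2, mult = undefined, one = undefined,
      zero = (\<zero>\<^bsub>M1\<^esub>, \<zero>\<^bsub>M2\<^esub>),
      add = (\<lambda>(x, y) (x', y'). (x \<oplus>\<^bsub>M1\<^esub> x', y \<oplus>\<^bsub>M2\<^esub> y')),
      smult = (\<lambda>(a, b, c) (x, y). (a \<odot>\<^bsub>M1\<^esub> x, b \<odot>\<^bsub>M2\<^esub> f x \<oplus>\<^bsub>M2\<^esub> c \<odot>\<^bsub>M2\<^esub> y))\<rparr>"

definition maps_obj ::
  "('r, 'x) ring_scheme \<Rightarrow> ('r, 'a) module \<Rightarrow> ('r, 'b) module \<Rightarrow> ('a \<Rightarrow> 'b) \<Rightarrow> bool" where
  "maps_obj L M1 M2 f \<longleftrightarrow> fg_module L M1 \<and> fg_module L M2 \<and> f \<in> lmod_hom L M1 M2"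

definition maps_hom ::
  "('r, 'x) ring_scheme \<Rightarrow> ('r, 'a) module \<Rightarrow> ('r, 'b) module \<Rightarrow> ('a \<Rightarrow> 'b) \<Rightarrow>
   ('r, 'c) module \<Rightarrow> ('r, 'd) module \<Rightarrow> ('c \<Rightarrow> 'd) \<Rightarrow> (('a \<Rightarrow> 'c) \<times> ('b \<Rightarrow> 'd)) set" where
  "maps_hom L M1 M2 f M1' M2' f' =
     {(a1, a2). a1 \<in> lmod_hom L M1 M1' \<and> a2 \<in> lmod_hom L M2 M2' \<and>
        (\<forall>x \<in> carrier M1. f' (a1 x) = a2 (f x))}"

text \<open>Under \<open>tri_module\<close>, the pairs in \<open>maps_hom\<close> are exactly the homomorphisms of modules over the
  triangular matrix ring that have the form \<open>map_prod a1 a2\<close>.\<close>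


lemma (in ring) tri_ring_is_ring: "ring (tri_ring R)"
proof (rule ringI)
  show "abelian_group (tri_ring R)"
  proof (rule abelian_groupI)
    fix x assume "x \<in> carrier (tri_ring R)"
    then show "\<exists>y\<in>carrier (tri_ring R). y \<oplus>\<^bsub>tri_ring R\<^esub> x = \<zero>\<^bsub>tri_ring R\<^esub>"
      by (cases x) (force simp: tri_ring_def l_neg intro!: bexI[where x="(\<ominus> fst x, \<ominus> fst (snd x), \<ominus> snd (snd x))"])
  qed (auto simp: tri_ring_def a_ac)
  show "monoid (tri_ring R)"
    by (rule monoidI) (auto simp: tri_ring_def m_assoc r_distr l_distr a_assoc)
qed (auto simp: tri_ring_def r_distr l_distr a_ac)

lemma left_module_tri_module:
  assumes "left_module L M1" "left_module L M2" "f \<in> lmod_hom L M1 M2"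
  shows "left_module (tri_ring L) (tri_module M1 M2 f)"
proof -
  interpret A: left_module L M1 by fact
  interpret B: left_module L M2 by fact
  have f [simp]: "\<And>x. x \<in> carrier M1 \<Longrightarrow> f x \<in> carrier M2"
    "\<And>x y. \<lbrakk>x \<in> carrier M1; y \<in> carrier M1\<rbrakk> \<Longrightarrow> f (x \<oplus>\<^bsub>M1\<^esub> y) = f x \<oplus>\<^bsub>M2\<^esub> f y"
    "\<And>r x. \<lbrakk>r \<in> carrier L; x \<in> carrier M1\<rbrakk> \<Longrightarrow> f (r \<odot>\<^bsub>M1\<^esub> x) = r \<odot>\<^bsub>M2\<^esub> f x"
    using assms(3) by (auto simp: lmod_hom_def)
  have z [simp]: "\<zero>\<^bsub>L\<^esub> \<odot>\<^bsub>M2\<^esub> y = \<zero>\<^bsub>M2\<^esub>" if "y \<in> carrier M2" for y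
    using that B.smult_l_distr[of "\<zero>\<^bsub>L\<^esub>" "\<zero>\<^bsub>L\<^esub>" y] B.smult_closed[of "\<zero>\<^bsub>L\<^esub>" y]
    by (metis A.R.l_zero A.R.zero_closed B.M.add.l_cancel_one')
  show ?thesis
  proof (intro left_module.intro left_module_axioms.intro)
    show "ring (tri_ring L)" by (rule A.R.tri_ring_is_ring)
    show "abelian_group (tri_module M1 M2 f)"
    proof (rule abelian_groupI)
      fix x assume "x \<in> carrier (tri_module M1 M2 f)"
      then show "\<exists>y\<in>carrier (tri_module M1 M2 f). y \<oplus>\<^bsub>tri_module M1 M2 f\<^esub> x = \<zero>\<^bsub>tri_module M1 M2 f\<^esub>"
        by (cases x) (force simp: tri_module_def A.M.l_neg B.M.l_neg
            intro!: bexI[where x="(\<ominus>\<^bsub>M1\<^esub> fst x, \<ominus>\<^bsub>M2\<^esub> snd x)"])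
    qed (auto simp: tri_module_def A.M.a_ac B.M.a_ac)
  qed (auto simp: tri_module_def tri_ring_def A.smult_closed B.smult_closed A.smult_l_distr
      B.smult_l_distr A.smult_r_distr B.smult_r_distr A.smult_assoc1 B.smult_assoc1 B.M.a_ac
      A.smult_one B.smult_one)
qed

lemma map_prod_mem_lmod_hom_iff:
  assumes M: "left_module L M1" "left_module L M2" "f \<in> lmod_hom L M1 M2"
    and N: "left_module L M1'" "left_module L M2'" "f' \<in> lmod_hom L M1' M2'"
  shows "map_prod a1 a2 \<in> lmod_hom (tri_ring L) (tri_module M1 M2 f) (tri_module M1' M2' f')
    \<longleftrightarrow> (a1, a2) \<in> maps_hom L M1 M2 f M1' M2' f'" (is "?l \<longleftrightarrow> ?r")
proof -
  interpret A: left_module L M1 by fact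
  interpret B: left_module L M2 by fact
  interpret A': left_module L M1' by fact
  interpret B': left_module L M2' by fact
  have f [simp]: "\<And>x. x \<in> carrier M1 \<Longrightarrow> f x \<in> carrier M2"
    using M(3) by (auto simp: lmod_hom_def)
  have f' [simp]: "\<And>x. x \<in> carrier M1' \<Longrightarrow> f' x \<in> carrier M2'"
    using N(3) by (auto simp: lmod_hom_def)
  have z: "\<zero>\<^bsub>L\<^esub> \<odot>\<^bsub>M2\<^esub> y = \<zero>\<^bsub>M2\<^esub>" if "y \<in> carrier M2" for y
    using that B.smult_l_distr[of "\<zero>\<^bsub>L\<^esub>" "\<zero>\<^bsub>L\<^esub>" y] B.smult_closed[of "\<zero>\<^bsub>L\<^esub>" y]
    by (metis A.R.l_zero A.R.zero_closed B.M.add.l_cancel_one')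
  have z': "\<zero>\<^bsub>L\<^esub> \<odot>\<^bsub>M2'\<^esub> y = \<zero>\<^bsub>M2'\<^esub>" if "y \<in> carrier M2'" for y
    using that B'.smult_l_distr[of "\<zero>\<^bsub>L\<^esub>" "\<zero>\<^bsub>L\<^esub>" y] B'.smult_closed[of "\<zero>\<^bsub>L\<^esub>" y]
    by (metis A.R.l_zero A.R.zero_closed B'.M.add.l_cancel_one')
  show ?thesis
  proof
    assume ?r
    then show ?l
      unfolding maps_hom_def lmod_hom_def tri_ring_def tri_module_def
      by (auto simp: Pi_iff A.smult_closed B.smult_closed B.M.add.m_closed)
  next
    assume L: ?l
    have c: "a1 x \<in> carrier M1'" "a2 y \<in> carrier M2'"
      if "x \<in> carrier M1" "y \<in> carrier M2" for x y
      using L that by (auto simp: lmod_hom_def tri_module_def Pi_iff)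
    have c1: "a1 x \<in> carrier M1'" if "x \<in> carrier M1" for x
      using c[OF that B.M.zero_closed] by simp
    have c2: "a2 x \<in> carrier M2'" if "x \<in> carrier M2" for x
      using c[OF A.M.zero_closed that] by simp
    have ad: "a1 (x \<oplus>\<^bsub>M1\<^esub> x') = a1 x \<oplus>\<^bsub>M1'\<^esub> a1 x' \<and> a2 (y \<oplus>\<^bsub>M2\<^esub> y') = a2 y \<oplus>\<^bsub>M2'\<^esub> a2 y'"
      if "x \<in> carrier M1" "x' \<in> carrier M1" "y \<in> carrier M2" "y' \<in> carrier M2" for x x' y y'
      using L that by (force simp: lmod_hom_def tri_module_def)
    have sm: "a1 (a \<odot>\<^bsub>M1\<^esub> x) = a \<odot>\<^bsub>M1'\<^esub> a1 x \<and>
        a2 (b \<odot>\<^bsub>M2\<^esub> f x \<oplus>\<^bsub>M2\<^esub> c \<odot>\<^bsub>M2\<^esub> y) = b \<odot>\<^bsub>M2'\<^esub> f' (a1 x) \<oplus>\<^bsub>M2'\<^esub> c \<odot>\<^bsub>M2'\<^esub> a2 y"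
      if "x \<in> carrier M1" "y \<in> carrier M2" "a \<in> carrier L" "b \<in> carrier L" "c \<in> carrier L"
      for x y a b c
    proof -
      have "map_prod a1 a2 ((a, b, c) \<odot>\<^bsub>tri_module M1 M2 f\<^esub> (x, y))
         = (a, b, c) \<odot>\<^bsub>tri_module M1' M2' f'\<^esub> map_prod a1 a2 (x, y)"
        using L that unfolding lmod_hom_def by (auto simp: tri_module_def tri_ring_def)
      then show ?thesis by (simp add: tri_module_def)
    qed
    have a2s: "a2 (c \<odot>\<^bsub>M2\<^esub> y) = c \<odot>\<^bsub>M2'\<^esub> a2 y" if "y \<in> carrier M2" "c \<in> carrier L" for y c
      using sm[of "\<zero>\<^bsub>M1\<^esub>" y "\<zero>\<^bsub>L\<^esub>" "\<zero>\<^bsub>L\<^esub>" c] that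
      by (simp add: z z' c1 c2 B.smult_closed B'.smult_closed)
    have "a2 (f x) = f' (a1 x)" if "x \<in> carrier M1" for x
      using sm[of x "\<zero>\<^bsub>M2\<^esub>" "\<one>\<^bsub>L\<^esub>" "\<one>\<^bsub>L\<^esub>" "\<zero>\<^bsub>L\<^esub>"] that
      by (simp add: z z' c1 c2 B.smult_one B'.smult_one)
    moreover have "a1 \<in> lmod_hom L M1 M1'"
      using ad[OF _ _ B.M.zero_closed B.M.zero_closed]
        sm[OF _ B.M.zero_closed _ A.R.zero_closed A.R.zero_closed] c1
      by (auto simp: lmod_hom_def)
    moreover have "a2 \<in> lmod_hom L M2 M2'"
      using ad[OF A.M.zero_closed A.M.zero_closed] a2s c2 by (auto simp: lmod_hom_def)
    ultimately show ?r by (auto simp: maps_hom_def)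
  qed
qed

end

theory Submission
  imports Defs "HOL-Algebra.Ring_Divisibility"
begin

text \<open>
  The lifting property of an almost split sequence is tested on a few morphisms, chosen so that a
  splitting of the test morphism would force \<open>f\<close> or \<open>g\<close> to split.

  On the right, the test morphisms into \<open>(M\<^sub>1, M\<^sub>2, f)\<close> are \<open>(1, f)\<close> from \<open>(M\<^sub>1, M\<^sub>1, 1)\<close>, \<open>(0, 1)\<close> from
  \<open>(0, M\<^sub>2, 0)\<close> and the inclusion of \<open>(M\<^sub>0, 0, 0)\<close>. Since \<open>f\<close> is neither a splittable monomorphism nor
  a splittable epimorphism, none of them splits, so each lifts to \<open>(E\<^sub>1, E\<^sub>2, h)\<close>
  (\<open>maps_right_almost_split_lift\<close>). The first component of the first lift, the second component
  of the second lift and the first component of the third lift are sections of \<open>p\<^sub>1\<close>, \<open>p\<^sub>2\<close> and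
  \<open>p\<^sub>0\<close>. In particular \<open>p\<^sub>0\<close> is onto, which is all that the left exact sequence of kernels lacks
  to be short exact (\<open>short_exact_kernels\<close>).

  On the left, the projection of \<open>(N\<^sub>1, N\<^sub>2, g)\<close> to \<open>(0, N\<^sub>3, 0)\<close> extends to \<open>(E\<^sub>1, E\<^sub>2, h)\<close>, because \<open>g\<close>
  is not a splittable monomorphism (\<open>maps_left_almost_split_lift\<close>). The extension induces a
  retraction of \<open>j\<^sub>3\<close>. So the right exact sequence of cokernels is short exact
  (\<open>short_exact_cokernels\<close>), and it splits (\<open>short_exact_retraction_imp_section\<close>).

  The kernels have to be finitely generated for this, both as test objects and as members of the
  resulting sequence. It is here that \<open>\<Lambda>\<close> must be an artin algebra: the artinian ground ring is
  noetherian by Akizuki's theorem (\<open>artinian_imp_noetherian\<close>), a finitely generated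
  \<open>\<Lambda>\<close>-module is finitely generated over the ground ring, and so its submodules are finitely
  generated (\<open>fg_submodule\<close>).
\<close>

section \<open>Artinian commutative rings are noetherian\<close>

lemma (in cring) idealI_comm:
  assumes "I \<subseteq> carrier R" "\<zero> \<in> I"
    and add: "\<And>a b. \<lbrakk>a \<in> I; b \<in> I\<rbrakk> \<Longrightarrow> a \<oplus> b \<in> I"
    and mult: "\<And>r a. \<lbrakk>r \<in> carrier R; a \<in> I\<rbrakk> \<Longrightarrow> r \<otimes> a \<in> I"
  shows "ideal I R"
proof (rule idealI)
  show "subgroup I (add_monoid R)"
  proof (rule add.subgroupI)
    fix a assume a: "a \<in> I"
    have "\<ominus> a = (\<ominus> \<one>) \<otimes> a"
      using a assms(1) by (auto simp: l_minus)
    then show "\<ominus> a \<in> I" using mult[of "\<ominus> \<one>" a] a by simp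
  qed (use assms in auto)
  show "a \<otimes> x \<in> I" if "a \<in> I" "x \<in> carrier R" for a x
    using that mult[of x a] assms(1) m_comm[of a x] by auto
qed (use mult ring_axioms in auto)

lemma (in cring) ideal_scaled:
  assumes "r \<in> carrier R" "ideal J R"
  shows "ideal ((\<otimes>) r ` J) R"
proof -
  interpret J: ideal J R by fact
  show ?thesis
  proof (rule idealI_comm)
    show "(\<otimes>) r ` J \<subseteq> carrier R"
      using assms(1) by auto
    show "\<zero> \<in> (\<otimes>) r ` J"
      using assms(1) by (force intro!: image_eqI[where x=\<zero>])
    fix a b assume "a \<in> (\<otimes>) r ` J" "b \<in> (\<otimes>) r ` J"
    then obtain x y where "a = r \<otimes> x" "b = r \<otimes> y" "x \<in> J" "y \<in> J" by auto
    then show "a \<oplus> b \<in> (\<otimes>) r ` J"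
      using assms(1) by (auto simp flip: r_distr intro!: image_eqI[where x="x \<oplus> y"])
  next
    fix s a assume s: "s \<in> carrier R" and "a \<in> (\<otimes>) r ` J"
    then obtain x where "a = r \<otimes> x" "x \<in> J" by auto
    then show "s \<otimes> a \<in> (\<otimes>) r ` J"
      using assms(1) s J.I_l_closed m_lcomm by (auto intro!: image_eqI[where x="s \<otimes> x"])
  qed
qed

text \<open>Replaces \<open>Idl A\<close> by its universal property, so that generation can be checked against an
  arbitrary ideal containing \<open>A\<close>.\<close>

lemma (in ring) finitely_generated_idealI:
  assumes "ideal I R" "finite A" "A \<subseteq> I" "\<And>L. \<lbrakk>ideal L R; A \<subseteq> L\<rbrakk> \<Longrightarrow> I \<subseteq> L"
  shows "\<exists>A \<subseteq> carrier R. finite A \<and> I = Idl A"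
proof (intro exI conjI)
  have "I \<subseteq> carrier R" using ideal.Icarr[OF assms(1)] by blast
  then show A: "A \<subseteq> carrier R" using assms by blast
  show "I = Idl A"
    using assms A genideal_minimal genideal_ideal genideal_self by (metis subset_antisym)
qed (fact assms)

lemma (in artinian_cring) minimal_ideal:
  assumes "ideal I R" "P I"
  obtains J where "ideal J R" "P J" "\<And>K. \<lbrakk>ideal K R; K \<subset> J\<rbrakk> \<Longrightarrow> \<not> P K"
proof -
  have "wf {(K, J). ideal K R \<and> ideal J R \<and> K \<subset> J}"
  proof (subst wf_iff_no_infinite_down_chain, rule notI, elim exE)
    fix I assume I: "\<forall>i. (I (Suc i), I i) \<in> {(K, J). ideal K R \<and> ideal J R \<and> K \<subset> J}"
    then obtain n where "\<forall>m\<ge>n. I m = I n"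
      using descending_chain[of I] by auto
    then have "I (Suc n) = I n" by (meson le_SucI order_refl)
    with I show False by blast
  qed
  then obtain J where "J \<in> {J. ideal J R \<and> P J}"
    "\<And>K. (K, J) \<in> {(K, J). ideal K R \<and> ideal J R \<and> K \<subset> J} \<Longrightarrow> K \<notin> {J. ideal J R \<and> P J}"
    using wfE_min[of _ I "{J. ideal J R \<and> P J}"] assms by blast
  then show thesis by (intro that[of J]) auto
qed

text \<open>Some power of \<open>r\<close> generates the same ideal as the next one, so \<open>r\<^sup>n (1 - r s) = 0\<close> for
  some \<open>s\<close>.\<close>

lemma (in artinian_cring) power_stable:
  assumes r: "r \<in> carrier R"
  obtains n :: nat and s where "s \<in> carrier R" "r [^] n \<otimes> (\<one> \<ominus> r \<otimes> s) = \<zero>"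
proof -
  define I where "I n = (\<otimes>) (r [^] (n::nat)) ` carrier R" for n
  have "ideal (I n) R" for n
    unfolding I_def using r by (intro ideal_scaled oneideal) auto
  moreover have "I (Suc n) \<subseteq> I n" for n
    unfolding I_def using r by (force simp: m_assoc)
  ultimately obtain n where "I (Suc n) = I n"
    using descending_chain[of I] by (metis le_SucI order_refl)
  moreover have "r [^] n \<in> I n"
    unfolding I_def using r by (force intro: image_eqI[where x=\<one>])
  ultimately obtain s where s: "s \<in> carrier R" "r [^] n = r [^] Suc n \<otimes> s"
    unfolding I_def by auto
  have "r [^] n \<otimes> (\<one> \<ominus> r \<otimes> s) = r [^] n \<ominus> r [^] Suc n \<otimes> s"
    using r s(1) by (simp add: minus_eq r_distr r_minus m_assoc)
  also have "\<dots> = \<zero>"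
    using r s by (metis minus_eq r_neg nat_pow_closed)
  finally show thesis using that s(1) by blast
qed

text \<open>Among the ideals that are not finitely generated, let \<open>I\<close> be a minimal one. For an element
  \<open>r\<close> of \<open>R\<close>, the ideals \<open>r I\<close> and \<open>{a \<in> I. r a = 0}\<close> cannot both be proper subideals of \<open>I\<close>, since
  generators of them would give generators of \<open>I\<close>. Thus \<open>r\<close> either annihilates \<open>I\<close> or is surjective
  on it, and in the second case it acts invertibly by \<open>power_stable\<close>. So \<open>I\<close> is a vector space
  over the field \<open>R/ann I\<close>. A complement of a line in \<open>I\<close>, obtained as an ideal maximal among
  those avoiding a nonzero \<open>x\<close>, is a proper subideal and hence finitely generated; adding \<open>x\<close>
  gives generators of \<open>I\<close>, a contradiction.\<close>

theorem (in artinian_cring) artinian_imp_noetherian: "noetherian_ring R"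
proof (rule noetherian_ringI, rule ccontr)
  define nonfg where "nonfg I \<longleftrightarrow> (\<nexists>A. A \<subseteq> carrier R \<and> finite A \<and> I = Idl A)" for I
  fix I0 assume "ideal I0 R" "\<nexists>A. A \<subseteq> carrier R \<and> finite A \<and> I0 = Idl A"
  then have "nonfg I0" by (simp add: nonfg_def)
  then obtain I where I: "ideal I R" and "nonfg I"
    and min_nonfg: "\<And>J. \<lbrakk>ideal J R; J \<subset> I\<rbrakk> \<Longrightarrow> \<not> nonfg J"
    using minimal_ideal[OF \<open>ideal I0 R\<close>, of nonfg] by blast
  then have nfg: "\<nexists>A. A \<subseteq> carrier R \<and> finite A \<and> I = Idl A"
    and min: "\<And>J. \<lbrakk>ideal J R; J \<subset> I\<rbrakk> \<Longrightarrow> \<exists>A\<subseteq>carrier R. finite A \<and> J = Idl A"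
    by (auto simp: nonfg_def)
  interpret I: ideal I R by (fact I)
  note carr = I.Icarr
  \<comment> \<open>By minimality a proper subideal \<open>J\<close> of \<open>I\<close> is finitely generated, so \<open>I\<close> cannot be generated by
    \<open>J\<close> and finitely many further elements.\<close>
  have extend: False
    if J: "ideal J R" "J \<subset> I" and A: "finite A" "A \<subseteq> I"
      and gen: "\<And>L. \<lbrakk>ideal L R; J \<subseteq> L; A \<subseteq> L\<rbrakk> \<Longrightarrow> I \<subseteq> L" for J A
  proof -
    obtain B where B: "B \<subseteq> carrier R" "finite B" "J = Idl B" using min[OF J] by blast
    have "\<exists>A\<subseteq>carrier R. finite A \<and> I = Idl A"
    proof (rule finitely_generated_idealI[OF I, of "B \<union> A"])
      show "B \<union> A \<subseteq> I" using genideal_self[OF B(1)] B(3) J A by blast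
      fix L assume L: "ideal L R" "B \<union> A \<subseteq> L"
      then have "J \<subseteq> L" using genideal_minimal[of L B] B(3) by simp
      then show "I \<subseteq> L" using gen L by blast
    qed (use A B in auto)
    then show False using nfg by blast
  qed
  have surj_or_zero: "(\<otimes>) r ` I = I \<or> (\<forall>a\<in>I. r \<otimes> a = \<zero>)" if r: "r \<in> carrier R" for r
  proof (rule ccontr)
    assume contr: "\<not> ?thesis"
    have "(\<otimes>) r ` I \<subset> I" using contr I.I_l_closed r by auto
    then obtain B where B: "B \<subseteq> carrier R" "finite B" "(\<otimes>) r ` I = Idl B"
      using min[OF ideal_scaled[OF r I]] by blast
    then have "B \<subseteq> (\<otimes>) r ` I" using genideal_self by blast
    then obtain A where A: "A \<subseteq> I" "finite A" "B = (\<otimes>) r ` A"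
      using B(2) by (meson finite_subset_image)
    define K where "K = {a \<in> I. r \<otimes> a = \<zero>}"
    have K: "ideal K R"
      by (rule idealI_comm)
        (use r carr I.I_l_closed in \<open>auto simp: K_def r_distr m_lcomm[of r]\<close>)
    have "K \<subset> I" using contr by (auto simp: K_def)
    from this A(2,1) show False
    proof (rule extend[OF K])
      fix L assume L: "ideal L R" "K \<subseteq> L" "A \<subseteq> L"
      have LI: "ideal (L \<inter> I) R" using L I i_intersect by blast
      have "Idl B \<subseteq> (\<otimes>) r ` (L \<inter> I)"
        using A L by (intro genideal_minimal ideal_scaled[OF r LI]) blast
      then have sub: "(\<otimes>) r ` I \<subseteq> (\<otimes>) r ` (L \<inter> I)" using B by simp
      show "I \<subseteq> L"
      proof
        fix a assume a: "a \<in> I"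
        with sub obtain l where l: "l \<in> L" "l \<in> I" "r \<otimes> a = r \<otimes> l" by blast
        then have "r \<otimes> (a \<ominus> l) = \<zero>"
          using a r carr by (simp add: minus_eq r_distr r_minus r_neg)
        moreover have "a \<ominus> l \<in> I" using a l by (simp add: minus_eq)
        ultimately have "a \<ominus> l \<in> L" using L by (auto simp: K_def)
        then have "(a \<ominus> l) \<oplus> l \<in> L"
          using l L additive_subgroup.a_closed ideal.axioms(1) by metis
        then show "a \<in> L"
          using a l carr by (simp add: minus_eq a_assoc l_neg)
      qed
    qed
  qed
  obtain x where x: "x \<in> I" "x \<noteq> \<zero>"
  proof (rule ccontr)
    assume "\<not> thesis"
    then have "I = {\<zero>}" using that I.zero_closed by blast
    then have "I = Idl {\<zero>}" using genideal_zero by simp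
    then show False using nfg by auto
  qed
  have invertible: "\<exists>s\<in>carrier R. \<forall>a\<in>I. s \<otimes> (r \<otimes> a) = a"
    if r: "r \<in> carrier R" "(\<otimes>) r ` I = I" for r
  proof -
    obtain n :: nat and s where s: "s \<in> carrier R" "r [^] n \<otimes> (\<one> \<ominus> r \<otimes> s) = \<zero>"
      using power_stable[OF r(1)] .
    define t where "t = \<one> \<ominus> r \<otimes> s"
    have t: "t \<in> carrier R" using r s by (simp add: t_def)
    have pow: "(\<otimes>) (r [^] (m::nat)) ` I = I" for m
    proof (induction m)
      case 0
      show ?case using carr by force
    next
      case (Suc m)
      have "(\<otimes>) (r [^] Suc m) ` I = (\<otimes>) (r [^] m) ` (\<otimes>) r ` I"
        using r(1) carr by (force simp: image_image m_assoc)
      then show ?case using r(2) Suc by simp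
    qed
    \<comment> \<open>Otherwise \<open>r\<^sup>n t\<close>, which is \<open>0\<close>, would map \<open>I\<close> onto \<open>I\<close>.\<close>
    have "(\<otimes>) t ` I \<noteq> I"
    proof
      assume t_surj: "(\<otimes>) t ` I = I"
      have "x \<in> (\<otimes>) (r [^] n) ` (\<otimes>) t ` I"
        unfolding t_surj pow by (fact x(1))
      then obtain y where "y \<in> I" "x = r [^] n \<otimes> (t \<otimes> y)" by (elim imageE) simp
      then have "x = (r [^] n \<otimes> t) \<otimes> y" using r t carr by (simp add: m_assoc)
      then show False using s x \<open>y \<in> I\<close> carr by (simp add: t_def)
    qed
    then have kill: "\<forall>a\<in>I. t \<otimes> a = \<zero>" using surj_or_zero[OF t] by blast
    have "s \<otimes> (r \<otimes> a) = a" if "a \<in> I" for a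
    proof -
      have "a \<ominus> (r \<otimes> s) \<otimes> a = \<zero>"
        using kill that r s carr by (simp add: t_def minus_eq l_distr l_minus)
      then have "(r \<otimes> s) \<otimes> a = a"
        using that r s carr by (metis r_right_minus_eq m_closed)
      then show ?thesis using that r s carr by (metis m_assoc m_comm)
    qed
    then show ?thesis using s by blast
  qed
  \<comment> \<open>A maximal element of this family is a complement of the line through \<open>x\<close>.\<close>
  define \<W> where "\<W> = {W. ideal W R \<and> W \<subseteq> I \<and> x \<notin> W}"
  have "\<exists>M\<in>\<W>. \<forall>X\<in>\<W>. M \<subseteq> X \<longrightarrow> X = M"
  proof (rule subset_Zorn_nonempty)
    have "{\<zero>} \<in> \<W>" using x zeroideal by (auto simp: \<W>_def)
    then show "\<W> \<noteq> {}" by blast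
    fix \<C> assume C: "\<C> \<noteq> {}" "subset.chain \<W> \<C>"
    then have "subset.chain {I. ideal I R} \<C>"
      by (auto simp: \<W>_def pred_on.chain_def)
    from chain_Union_is_ideal[OF this] C have "ideal (\<Union>\<C>) R" by simp
    then show "\<Union>\<C> \<in> \<W>" using C by (auto simp: \<W>_def pred_on.chain_def)
  qed
  then obtain W where W: "ideal W R" "W \<subseteq> I" "x \<notin> W"
    and max: "\<And>X. \<lbrakk>ideal X R; X \<subseteq> I; x \<notin> X; W \<subseteq> X\<rbrakk> \<Longrightarrow> X = W"
    by (auto simp: \<W>_def)
  interpret W: ideal W R by (fact W(1))
  have "W \<subset> I" using W x by blast
  then show False
  proof (rule extend[OF W(1), where A="{x}"])
    fix L assume L: "ideal L R" "W \<subseteq> L" "{x} \<subseteq> L"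
    interpret L: ideal L R by fact
    show "I \<subseteq> L"
    proof (rule subsetI, rule ccontr)
      fix y assume y: "y \<in> I" "y \<notin> L"
      have yc: "y \<in> carrier R" using y carr by blast
      have P: "ideal (PIdl y) R" using yc by (rule cgenideal_ideal)
      have PI: "PIdl y \<subseteq> I" using I y by (simp add: cgenideal_minimal)
      have sum: "ideal (W <+> PIdl y) R" using W(1) P by (rule add_ideals)
      have "W \<subseteq> W <+> PIdl y"
      proof
        fix w assume w: "w \<in> W"
        then have "w \<oplus> \<zero> \<in> W <+> PIdl y"
          using additive_subgroup.zero_closed[OF ideal.axioms(1)[OF P]]
          unfolding set_add_def' by blast
        then show "w \<in> W <+> PIdl y" using w W.Icarr by simp
      qed
      moreover have "W <+> PIdl y \<subseteq> I"
        using W(2) PI unfolding set_add_def' by auto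
      moreover have "\<zero> \<oplus> y \<in> W <+> PIdl y"
        using cgenideal_self[OF yc] W.zero_closed unfolding set_add_def' by blast
      then have "y \<in> W <+> PIdl y" using yc by simp
      ultimately have "x \<in> W <+> PIdl y"
        using max[OF sum] y(2) L(2) by blast
      then obtain w r where w: "w \<in> W" "r \<in> carrier R" "x = w \<oplus> r \<otimes> y"
        unfolding set_add_def' cgenideal_def by auto
      have wc: "w \<in> carrier R" using w W.Icarr by blast
      have "r \<otimes> y \<noteq> \<zero>" using w W(3) wc by auto
      then have "(\<otimes>) r ` I = I"
        using surj_or_zero[OF w(2)] y(1) by (elim disjE) simp_all
      from invertible[OF w(2) this]
      obtain s where s: "s \<in> carrier R" "\<forall>a\<in>I. s \<otimes> (r \<otimes> a) = a" ..
      have "s \<otimes> x = s \<otimes> w \<oplus> y"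
        using w wc yc s y(1) by (simp add: r_distr)
      then have "s \<otimes> x \<ominus> s \<otimes> w = y"
        using wc yc s(1) by (simp add: minus_eq a_ac r_neg)
      moreover have "s \<otimes> x \<ominus> s \<otimes> w \<in> L"
        using L w s(1) by (auto simp: minus_eq L.I_l_closed)
      ultimately show False using y by simp
    qed
  qed (use x in auto)
qed

section \<open>Submodules and generators\<close>

lemma submoduleD:
  assumes "submodule N R M"
  shows submodule_subset: "N \<subseteq> carrier M"
    and submodule_zero: "\<zero>\<^bsub>M\<^esub> \<in> N"
    and submodule_add: "\<lbrakk>x \<in> N; y \<in> N\<rbrakk> \<Longrightarrow> x \<oplus>\<^bsub>M\<^esub> y \<in> N"
    and submodule_smult: "\<lbrakk>r \<in> carrier R; x \<in> N\<rbrakk> \<Longrightarrow> r \<odot>\<^bsub>M\<^esub> x \<in> N"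
  using subgroup.subset[OF submodule.axioms(1)[OF assms]]
    subgroup.one_closed[OF submodule.axioms(1)[OF assms]]
    subgroup.m_closed[OF submodule.axioms(1)[OF assms]]
    submodule.smult_closed[OF assms] by simp_all

lemma (in abelian_monoid) finsum_mem:
  assumes "N \<subseteq> carrier G" "\<zero> \<in> N" "\<And>x y. \<lbrakk>x \<in> N; y \<in> N\<rbrakk> \<Longrightarrow> x \<oplus> y \<in> N"
    and "\<And>a. a \<in> A \<Longrightarrow> f a \<in> N"
  shows "(\<Oplus>a\<in>A. f a) \<in> N"
proof (cases "finite A")
  case True
  then show ?thesis
    using assms(4)
  proof (induction A rule: finite_induct)
    case (insert a A)
    then show ?case using assms(1,3) by (subst finsum_insert) (auto simp: subset_iff)
  qed (use assms(2) in simp)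
qed (use assms(2) in \<open>simp add: finsum_infinite\<close>)

definition module_span :: "('r, 'x) ring_scheme \<Rightarrow> ('r, 'a, 'y) module_scheme \<Rightarrow> 'a set \<Rightarrow> 'a set" where
  "module_span R M S = \<Inter>{N. submodule N R M \<and> S \<subseteq> N}"

lemma module_span_least: "\<lbrakk>submodule N R M; S \<subseteq> N\<rbrakk> \<Longrightarrow> module_span R M S \<subseteq> N"
  unfolding module_span_def by blast

lemma module_span_superset: "S \<subseteq> module_span R M S"
  unfolding module_span_def by blast

lemma module_span_mono: "S \<subseteq> T \<Longrightarrow> module_span R M S \<subseteq> module_span R M T"
  unfolding module_span_def by blast

context left_module
begin

lemma smult_zero_left [simp]: "x \<in> carrier M \<Longrightarrow> \<zero>\<^bsub>R\<^esub> \<odot>\<^bsub>M\<^esub> x = \<zero>\<^bsub>M\<^esub>"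
  using smult_l_distr[of "\<zero>\<^bsub>R\<^esub>" "\<zero>\<^bsub>R\<^esub>" x] smult_closed[of "\<zero>\<^bsub>R\<^esub>" x]
  by (metis R.l_zero R.zero_closed M.add.l_cancel_one')

lemma smult_zero_right [simp]: "r \<in> carrier R \<Longrightarrow> r \<odot>\<^bsub>M\<^esub> \<zero>\<^bsub>M\<^esub> = \<zero>\<^bsub>M\<^esub>"
  using smult_r_distr[of r "\<zero>\<^bsub>M\<^esub>" "\<zero>\<^bsub>M\<^esub>"] smult_closed[of r "\<zero>\<^bsub>M\<^esub>"]
  by (metis M.l_zero M.zero_closed M.add.l_cancel_one')

lemma smult_minus_one: "x \<in> carrier M \<Longrightarrow> (\<ominus>\<^bsub>R\<^esub> \<one>\<^bsub>R\<^esub>) \<odot>\<^bsub>M\<^esub> x = \<ominus>\<^bsub>M\<^esub> x"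
  using smult_l_distr[of "\<ominus>\<^bsub>R\<^esub> \<one>\<^bsub>R\<^esub>" "\<one>\<^bsub>R\<^esub>" x] smult_closed[of "\<ominus>\<^bsub>R\<^esub> \<one>\<^bsub>R\<^esub>" x]
  by (metis M.minus_equality R.add.inv_closed R.l_neg R.one_closed smult_one smult_zero_left)

lemma submoduleI:
  assumes "N \<subseteq> carrier M" "\<zero>\<^bsub>M\<^esub> \<in> N"
    and "\<And>x y. \<lbrakk>x \<in> N; y \<in> N\<rbrakk> \<Longrightarrow> x \<oplus>\<^bsub>M\<^esub> y \<in> N"
    and smult: "\<And>r x. \<lbrakk>r \<in> carrier R; x \<in> N\<rbrakk> \<Longrightarrow> r \<odot>\<^bsub>M\<^esub> x \<in> N"
  shows "submodule N R M"
proof (intro submodule.intro submodule_axioms.intro)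
  show "subgroup N (add_monoid M)"
  proof (rule M.add.subgroupI)
    fix x assume x: "x \<in> N"
    then show "\<ominus>\<^bsub>M\<^esub> x \<in> N"
      using smult[of "\<ominus>\<^bsub>R\<^esub> \<one>\<^bsub>R\<^esub>" x] assms(1) by (auto simp: smult_minus_one)
  qed (use assms in auto)
qed (use smult in auto)

lemma submodule_minus:
  assumes N: "submodule N R M" "x \<in> N" "y \<in> N"
  shows "x \<ominus>\<^bsub>M\<^esub> y \<in> N"
proof -
  have "(\<ominus>\<^bsub>R\<^esub> \<one>\<^bsub>R\<^esub>) \<odot>\<^bsub>M\<^esub> y \<in> N" using N by (intro submodule_smult[OF N(1)]) auto
  then have "\<ominus>\<^bsub>M\<^esub> y \<in> N"
    using N(3) submodule_subset[OF N(1)] by (simp add: smult_minus_one subset_iff)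
  then show ?thesis
    unfolding a_minus_def by (rule submodule_add[OF N(1,2)])
qed

lemma submodule_carrier: "submodule (carrier M) R M"
  by (rule submoduleI) (auto simp: smult_closed)

lemma submodule_Inter:
  assumes "\<N> \<noteq> {}" "\<And>N. N \<in> \<N> \<Longrightarrow> submodule N R M"
  shows "submodule (\<Inter>\<N>) R M"
proof (rule submoduleI)
  show "\<Inter>\<N> \<subseteq> carrier M" using assms submodule_subset by blast
  show "\<zero>\<^bsub>M\<^esub> \<in> \<Inter>\<N>" using submodule_zero[OF assms(2)] by blast
  show "x \<oplus>\<^bsub>M\<^esub> y \<in> \<Inter>\<N>" if "x \<in> \<Inter>\<N>" "y \<in> \<Inter>\<N>" for x y
    using that submodule_add[OF assms(2)] by blast
  show "r \<odot>\<^bsub>M\<^esub> x \<in> \<Inter>\<N>" if "r \<in> carrier R" "x \<in> \<Inter>\<N>" for r x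
    using that submodule_smult[OF assms(2)] by blast
qed

lemma submodule_Int: "\<lbrakk>submodule N R M; submodule N' R M\<rbrakk> \<Longrightarrow> submodule (N \<inter> N') R M"
  using submodule_Inter[of "{N, N'}"] by auto

lemma submodule_module_span:
  assumes "S \<subseteq> carrier M"
  shows "submodule (module_span R M S) R M"
  unfolding module_span_def using submodule_carrier assms by (intro submodule_Inter) auto

lemma smult_finsum:
  assumes "finite A" "r \<in> carrier R" "f \<in> A \<rightarrow> carrier M"
  shows "r \<odot>\<^bsub>M\<^esub> (\<Oplus>\<^bsub>M\<^esub>a\<in>A. f a) = (\<Oplus>\<^bsub>M\<^esub>a\<in>A. r \<odot>\<^bsub>M\<^esub> f a)"
  using assms(1,3)
proof (induction A rule: finite_induct)
  case (insert a A)
  then have "f a \<in> carrier M" "f \<in> A \<rightarrow> carrier M" by auto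
  moreover from this have "(\<lambda>a. r \<odot>\<^bsub>M\<^esub> f a) \<in> A \<rightarrow> carrier M"
    using assms(2) by (auto simp: smult_closed Pi_iff)
  ultimately show ?case
    using insert assms(2) by (simp add: M.finsum_insert smult_r_distr smult_closed)
qed (use assms(2) in simp)

lemma submodule_linear_combinations:
  assumes S: "finite S" "S \<subseteq> carrier M"
  shows "submodule {\<Oplus>\<^bsub>M\<^esub>s\<in>S. a s \<odot>\<^bsub>M\<^esub> s | a. a \<in> S \<rightarrow> carrier R} R M" (is "submodule ?C R M")
proof (rule submoduleI)
  have mem: "(\<lambda>s. a s \<odot>\<^bsub>M\<^esub> s) \<in> S \<rightarrow> carrier M" if "a \<in> S \<rightarrow> carrier R" for a
    using S(2) that by (auto simp: smult_closed Pi_iff subset_iff)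
  show "?C \<subseteq> carrier M"
    using mem by (auto intro!: M.finsum_closed)
  have "\<zero>\<^bsub>M\<^esub> = (\<Oplus>\<^bsub>M\<^esub>s\<in>S. \<zero>\<^bsub>R\<^esub> \<odot>\<^bsub>M\<^esub> s)"
    using S(2) by (intro M.add.finprod_one_eqI[symmetric, simplified]) auto
  then show "\<zero>\<^bsub>M\<^esub> \<in> ?C" by (auto intro!: exI[of _ "\<lambda>_. \<zero>\<^bsub>R\<^esub>"])
  fix x y assume "x \<in> ?C" "y \<in> ?C"
  then obtain a b where a: "a \<in> S \<rightarrow> carrier R" "x = (\<Oplus>\<^bsub>M\<^esub>s\<in>S. a s \<odot>\<^bsub>M\<^esub> s)"
    and b: "b \<in> S \<rightarrow> carrier R" "y = (\<Oplus>\<^bsub>M\<^esub>s\<in>S. b s \<odot>\<^bsub>M\<^esub> s)" by auto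
  have "x \<oplus>\<^bsub>M\<^esub> y = (\<Oplus>\<^bsub>M\<^esub>s\<in>S. a s \<odot>\<^bsub>M\<^esub> s \<oplus>\<^bsub>M\<^esub> b s \<odot>\<^bsub>M\<^esub> s)"
    unfolding a b using mem a(1) b(1) by (intro M.finsum_addf[symmetric]) auto
  also have "\<dots> = (\<Oplus>\<^bsub>M\<^esub>s\<in>S. (a s \<oplus>\<^bsub>R\<^esub> b s) \<odot>\<^bsub>M\<^esub> s)"
    using a(1) b(1) S(2) by (intro M.finsum_cong') (auto simp: smult_l_distr smult_closed Pi_iff subset_iff)
  finally show "x \<oplus>\<^bsub>M\<^esub> y \<in> ?C"
    using a(1) b(1) by (auto intro!: exI[of _ "\<lambda>s. a s \<oplus>\<^bsub>R\<^esub> b s"])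
next
  fix r x assume r: "r \<in> carrier R" and "x \<in> ?C"
  then obtain a where a: "a \<in> S \<rightarrow> carrier R" "x = (\<Oplus>\<^bsub>M\<^esub>s\<in>S. a s \<odot>\<^bsub>M\<^esub> s)" by auto
  have "r \<odot>\<^bsub>M\<^esub> x = (\<Oplus>\<^bsub>M\<^esub>s\<in>S. r \<odot>\<^bsub>M\<^esub> (a s \<odot>\<^bsub>M\<^esub> s))"
    unfolding a using a(1) r S by (intro smult_finsum) (auto simp: smult_closed Pi_iff subset_iff)
  also have "\<dots> = (\<Oplus>\<^bsub>M\<^esub>s\<in>S. (r \<otimes>\<^bsub>R\<^esub> a s) \<odot>\<^bsub>M\<^esub> s)"
    using a(1) r S(2) by (intro M.finsum_cong') (auto simp: smult_assoc1 smult_closed Pi_iff subset_iff)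
  finally show "r \<odot>\<^bsub>M\<^esub> x \<in> ?C"
    using a(1) r by (auto intro!: exI[of _ "\<lambda>s. r \<otimes>\<^bsub>R\<^esub> a s"])
qed

lemma generator_linear_combination:
  assumes S: "finite S" "S \<subseteq> carrier M" "t \<in> S"
  shows "t \<in> {\<Oplus>\<^bsub>M\<^esub>s\<in>S. a s \<odot>\<^bsub>M\<^esub> s | a. a \<in> S \<rightarrow> carrier R}"
proof -
  define a where "a s = (if t = s then \<one>\<^bsub>R\<^esub> else \<zero>\<^bsub>R\<^esub>)" for s
  have "(\<Oplus>\<^bsub>M\<^esub>s\<in>S. a s \<odot>\<^bsub>M\<^esub> s) = (\<Oplus>\<^bsub>M\<^esub>s\<in>S. if t = s then s else \<zero>\<^bsub>M\<^esub>)"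
  proof (rule M.finsum_cong')
    show "(\<lambda>s. if t = s then s else \<zero>\<^bsub>M\<^esub>) \<in> S \<rightarrow> carrier M" using S(2) by auto
    show "a s \<odot>\<^bsub>M\<^esub> s = (if t = s then s else \<zero>\<^bsub>M\<^esub>)" if "s \<in> S" for s
      using that S(2) by (auto simp: a_def smult_one)
  qed simp
  also have "\<dots> = t"
    using M.finsum_singleton[OF S(3,1), of "\<lambda>s. s"] S(2) by (simp add: subset_iff)
  finally have "t = (\<Oplus>\<^bsub>M\<^esub>s\<in>S. a s \<odot>\<^bsub>M\<^esub> s)" ..
  moreover have "a \<in> S \<rightarrow> carrier R" by (simp add: a_def)
  ultimately show ?thesis by blast
qed

end

lemma fg_moduleI:
  assumes "left_module R M" "finite S" "S \<subseteq> carrier M"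
    and gen: "\<And>N. \<lbrakk>submodule N R M; S \<subseteq> N\<rbrakk> \<Longrightarrow> carrier M \<subseteq> N"
  shows "fg_module R M"
proof -
  interpret left_module R M by fact
  have "carrier M \<subseteq> {\<Oplus>\<^bsub>M\<^esub>s\<in>S. a s \<odot>\<^bsub>M\<^esub> s | a. a \<in> S \<rightarrow> carrier R}"
    by (intro gen submodule_linear_combinations assms(2,3) subsetI
        generator_linear_combination)
  then have "\<forall>x \<in> carrier M. \<exists>a \<in> S \<rightarrow> carrier R. x = (\<Oplus>\<^bsub>M\<^esub>s \<in> S. a s \<odot>\<^bsub>M\<^esub> s)"
    by blast
  then show ?thesis
    using assms(2,3) by unfold_locales (intro exI[of _ S] conjI)
qed

lemma fg_moduleE:
  assumes "fg_module R M"
  obtains S where "finite S" "S \<subseteq> carrier M"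
    "\<And>N. \<lbrakk>submodule N R M; S \<subseteq> N\<rbrakk> \<Longrightarrow> carrier M \<subseteq> N"
proof -
  interpret fg_module R M by fact
  obtain S where S: "finite S" "S \<subseteq> carrier M"
    "\<forall>x \<in> carrier M. \<exists>a \<in> S \<rightarrow> carrier R. x = (\<Oplus>\<^bsub>M\<^esub>s \<in> S. a s \<odot>\<^bsub>M\<^esub> s)"
    using finitely_generated by blast
  have "carrier M \<subseteq> N" if N: "submodule N R M" "S \<subseteq> N" for N
  proof
    fix x assume "x \<in> carrier M"
    then obtain a where a: "a \<in> S \<rightarrow> carrier R" "x = (\<Oplus>\<^bsub>M\<^esub>s \<in> S. a s \<odot>\<^bsub>M\<^esub> s)"
      using S(3) by blast
    show "x \<in> N"
      unfolding a(2)
    proof (rule M.finsum_mem)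
      show "a s \<odot>\<^bsub>M\<^esub> s \<in> N" if "s \<in> S" for s
        using that a(1) N(2) by (intro submodule_smult[OF N(1)]) auto
    qed (fact submoduleD(1-3)[OF N(1)])+
  qed
  then show thesis using S(1,2) that by blast
qed

lemma fg_module_imp_left_module: "fg_module R M \<Longrightarrow> left_module R M"
  by (rule fg_module.axioms(1))

text \<open>The module axioms and finite generation pass to any structure \<open>N\<close> onto which \<open>M\<close> is mapped
  compatibly with the operations. This covers quotients as well as copies of \<open>M\<close> on another type.\<close>

lemma fg_module_image:
  assumes "fg_module R M"
    and carr: "carrier N = q ` carrier M" and zero: "\<zero>\<^bsub>N\<^esub> = q \<zero>\<^bsub>M\<^esub>"
    and add: "\<And>x y. \<lbrakk>x \<in> carrier M; y \<in> carrier M\<rbrakk> \<Longrightarrow> q x \<oplus>\<^bsub>N\<^esub> q y = q (x \<oplus>\<^bsub>M\<^esub> y)"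
    and smult: "\<And>r x. \<lbrakk>r \<in> carrier R; x \<in> carrier M\<rbrakk> \<Longrightarrow> r \<odot>\<^bsub>N\<^esub> q x = q (r \<odot>\<^bsub>M\<^esub> x)"
  shows "fg_module R N"
proof -
  interpret M: fg_module R M by fact
  have "abelian_group N"
  proof (rule abelian_groupI)
    fix x assume "x \<in> carrier N"
    then obtain y where y: "y \<in> carrier M" "x = q y" using carr by auto
    then show "\<exists>y\<in>carrier N. y \<oplus>\<^bsub>N\<^esub> x = \<zero>\<^bsub>N\<^esub>"
      by (auto simp: carr zero add M.M.l_neg intro!: bexI[of _ "\<ominus>\<^bsub>M\<^esub> y"])
  qed (auto simp: carr zero add M.M.a_ac)
  then have N: "left_module R N"
    by (intro left_module.intro left_module_axioms.intro M.R.ring_axioms)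
      (auto simp: carr add smult M.smult_closed M.smult_l_distr M.smult_r_distr M.smult_assoc1
        M.smult_one)
  obtain S where S: "finite S" "S \<subseteq> carrier M"
    and gen: "\<And>N. \<lbrakk>submodule N R M; S \<subseteq> N\<rbrakk> \<Longrightarrow> carrier M \<subseteq> N"
    using fg_moduleE[OF assms(1)] by blast
  show ?thesis
  proof (rule fg_moduleI[OF N])
    show "finite (q ` S)" "q ` S \<subseteq> carrier N" using S carr by auto
    fix N' assume N': "submodule N' R N" "q ` S \<subseteq> N'"
    have "submodule {x \<in> carrier M. q x \<in> N'} R M"
    proof (rule M.submoduleI)
      show "x \<oplus>\<^bsub>M\<^esub> y \<in> {x \<in> carrier M. q x \<in> N'}"
        if "x \<in> {x \<in> carrier M. q x \<in> N'}" "y \<in> {x \<in> carrier M. q x \<in> N'}" for x y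
        using that submodule_add[OF N'(1), of "q x" "q y"] by (simp add: add)
      show "r \<odot>\<^bsub>M\<^esub> x \<in> {x \<in> carrier M. q x \<in> N'}"
        if "r \<in> carrier R" "x \<in> {x \<in> carrier M. q x \<in> N'}" for r x
        using that submodule_smult[OF N'(1), of r "q x"] by (simp add: smult M.smult_closed)
    qed (use submodule_zero[OF N'(1)] zero in auto)
    then have "carrier M \<subseteq> {x \<in> carrier M. q x \<in> N'}"
      using gen S N'(2) by blast
    then show "carrier N \<subseteq> N'" unfolding carr by auto
  qed
qed

lemma (in left_module) submodule_left_module:
  assumes "submodule N R M"
  shows "left_module R (M\<lparr>carrier := N\<rparr>)"
proof (intro left_module.intro left_module_axioms.intro R.ring_axioms)
  note N = submoduleD[OF assms]
  have c: "x \<in> carrier M" if "x \<in> N" for x using that N(1) by blast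
  show "abelian_group (M\<lparr>carrier := N\<rparr>)"
  proof (rule abelian_groupI)
    fix x assume x: "x \<in> carrier (M\<lparr>carrier := N\<rparr>)"
    then have "\<zero>\<^bsub>M\<^esub> \<ominus>\<^bsub>M\<^esub> x \<in> N" "x \<in> carrier M"
      using N submodule_minus[OF assms] by auto
    then show "\<exists>y\<in>carrier (M\<lparr>carrier := N\<rparr>). y \<oplus>\<^bsub>M\<lparr>carrier := N\<rparr>\<^esub> x = \<zero>\<^bsub>M\<lparr>carrier := N\<rparr>\<^esub>"
      by (auto simp: M.l_neg a_minus_def intro!: bexI[of _ "\<zero>\<^bsub>M\<^esub> \<ominus>\<^bsub>M\<^esub> x"])
  qed (auto simp: M.a_ac c N(2-4))
next
  let ?N = "M\<lparr>carrier := N\<rparr>"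
  note N = submoduleD[OF assms]
  have c: "x \<in> carrier M" if "x \<in> N" for x using that N(1) by blast
  fix x assume x: "x \<in> carrier ?N"
  then show "\<one>\<^bsub>R\<^esub> \<odot>\<^bsub>?N\<^esub> x = x" using c[of x] by (simp add: smult_one)
  fix a assume a: "a \<in> carrier R"
  then show "a \<odot>\<^bsub>?N\<^esub> x \<in> carrier ?N" using x N(4)[of a x] by simp
  show "a \<odot>\<^bsub>?N\<^esub> (x \<oplus>\<^bsub>?N\<^esub> y) = a \<odot>\<^bsub>?N\<^esub> x \<oplus>\<^bsub>?N\<^esub> a \<odot>\<^bsub>?N\<^esub> y" if "y \<in> carrier ?N" for y
    using a x that c[of x] c[of y] by (simp add: smult_r_distr)
  show "(a \<oplus>\<^bsub>R\<^esub> b) \<odot>\<^bsub>?N\<^esub> x = a \<odot>\<^bsub>?N\<^esub> x \<oplus>\<^bsub>?N\<^esub> b \<odot>\<^bsub>?N\<^esub> x"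
    "(a \<otimes>\<^bsub>R\<^esub> b) \<odot>\<^bsub>?N\<^esub> x = a \<odot>\<^bsub>?N\<^esub> (b \<odot>\<^bsub>?N\<^esub> x)" if "b \<in> carrier R" for b
    using a x that c[of x] by (simp_all add: smult_l_distr smult_assoc1)
qed

lemma (in left_module) submodule_trans:
  assumes "submodule N R M" "submodule N' R (M\<lparr>carrier := N\<rparr>)"
  shows "submodule N' R M"
proof (rule submoduleI)
  show "N' \<subseteq> carrier M"
    using submodule_subset[OF assms(1)] submodule_subset[OF assms(2)] by simp
  show "\<zero>\<^bsub>M\<^esub> \<in> N'" using submodule_zero[OF assms(2)] by simp
  show "x \<oplus>\<^bsub>M\<^esub> y \<in> N'" if "x \<in> N'" "y \<in> N'" for x y
    using submodule_add[OF assms(2) that] by simp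
  show "r \<odot>\<^bsub>M\<^esub> x \<in> N'" if "r \<in> carrier R" "x \<in> N'" for r x
    using submodule_smult[OF assms(2) that] by simp
qed

lemma (in left_module) fg_submoduleI:
  assumes "submodule N R M" "finite F" "F \<subseteq> N" "N \<subseteq> module_span R M F"
  shows "fg_module R (M\<lparr>carrier := N\<rparr>)"
proof (rule fg_moduleI[OF submodule_left_module[OF assms(1)] assms(2)])
  fix N' assume "submodule N' R (M\<lparr>carrier := N\<rparr>)" "F \<subseteq> N'"
  then have "module_span R M F \<subseteq> N'"
    using submodule_trans[OF assms(1)] by (intro module_span_least)
  then show "carrier (M\<lparr>carrier := N\<rparr>) \<subseteq> N'" using assms(4) by simp
qed (use assms in auto)


section \<open>Submodules of finitely generated modules over an artin algebra\<close>

text \<open>The ideal of leading coefficients from the proof of Hilbert's basis theorem, for elements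
  \<open>r x + u\<close> of the submodule \<open>T\<close> with \<open>u\<close> in \<open>U\<close> in place of polynomials. Commutativity is what
  makes this set a two-sided ideal.\<close>

lemma (in left_module) ideal_of_leading_coefficients:
  assumes "cring R" and T: "submodule T R M" and U: "submodule U R M" and x: "x \<in> carrier M"
  shows "ideal {r \<in> carrier R. \<exists>u\<in>U. r \<odot>\<^bsub>M\<^esub> x \<oplus>\<^bsub>M\<^esub> u \<in> T} R"
proof -
  interpret cring R by fact
  have Uc: "u \<in> carrier M" if "u \<in> U" for u using that submodule_subset[OF U] by blast
  show ?thesis
  proof (rule idealI_comm)
    show "\<zero>\<^bsub>R\<^esub> \<in> {r \<in> carrier R. \<exists>u\<in>U. r \<odot>\<^bsub>M\<^esub> x \<oplus>\<^bsub>M\<^esub> u \<in> T}"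
      using x submodule_zero[OF T] submodule_zero[OF U] by (auto intro!: bexI[of _ "\<zero>\<^bsub>M\<^esub>"])
    fix r s assume "r \<in> {r \<in> carrier R. \<exists>u\<in>U. r \<odot>\<^bsub>M\<^esub> x \<oplus>\<^bsub>M\<^esub> u \<in> T}"
      "s \<in> {r \<in> carrier R. \<exists>u\<in>U. r \<odot>\<^bsub>M\<^esub> x \<oplus>\<^bsub>M\<^esub> u \<in> T}"
    then obtain u v where r: "r \<in> carrier R" "u \<in> U" "r \<odot>\<^bsub>M\<^esub> x \<oplus>\<^bsub>M\<^esub> u \<in> T"
      and s: "s \<in> carrier R" "v \<in> U" "s \<odot>\<^bsub>M\<^esub> x \<oplus>\<^bsub>M\<^esub> v \<in> T" by auto
    have "(r \<oplus>\<^bsub>R\<^esub> s) \<odot>\<^bsub>M\<^esub> x \<oplus>\<^bsub>M\<^esub> (u \<oplus>\<^bsub>M\<^esub> v) =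
      (r \<odot>\<^bsub>M\<^esub> x \<oplus>\<^bsub>M\<^esub> u) \<oplus>\<^bsub>M\<^esub> (s \<odot>\<^bsub>M\<^esub> x \<oplus>\<^bsub>M\<^esub> v)"
      using r s x Uc by (simp add: smult_l_distr smult_closed M.a_ac)
    then have "(r \<oplus>\<^bsub>R\<^esub> s) \<odot>\<^bsub>M\<^esub> x \<oplus>\<^bsub>M\<^esub> (u \<oplus>\<^bsub>M\<^esub> v) \<in> T"
      using submodule_add[OF T r(3) s(3)] by simp
    then show "r \<oplus>\<^bsub>R\<^esub> s \<in> {r \<in> carrier R. \<exists>u\<in>U. r \<odot>\<^bsub>M\<^esub> x \<oplus>\<^bsub>M\<^esub> u \<in> T}"
      using r(1) s(1) submodule_add[OF U r(2) s(2)] by blast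
  next
    fix s r assume s: "s \<in> carrier R" "r \<in> {r \<in> carrier R. \<exists>u\<in>U. r \<odot>\<^bsub>M\<^esub> x \<oplus>\<^bsub>M\<^esub> u \<in> T}"
    then obtain u where r: "r \<in> carrier R" "u \<in> U" "r \<odot>\<^bsub>M\<^esub> x \<oplus>\<^bsub>M\<^esub> u \<in> T" by auto
    have "(s \<otimes>\<^bsub>R\<^esub> r) \<odot>\<^bsub>M\<^esub> x \<oplus>\<^bsub>M\<^esub> s \<odot>\<^bsub>M\<^esub> u = s \<odot>\<^bsub>M\<^esub> (r \<odot>\<^bsub>M\<^esub> x \<oplus>\<^bsub>M\<^esub> u)"
      using r s(1) x Uc by (simp add: smult_assoc1 smult_r_distr smult_closed)
    then have "(s \<otimes>\<^bsub>R\<^esub> r) \<odot>\<^bsub>M\<^esub> x \<oplus>\<^bsub>M\<^esub> s \<odot>\<^bsub>M\<^esub> u \<in> T"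
      using submodule_smult[OF T s(1) r(3)] by simp
    then show "s \<otimes>\<^bsub>R\<^esub> r \<in> {r \<in> carrier R. \<exists>u\<in>U. r \<odot>\<^bsub>M\<^esub> x \<oplus>\<^bsub>M\<^esub> u \<in> T}"
      using r(1) s(1) submodule_smult[OF U s(1) r(2)] by blast
  qed auto
qed

lemma (in left_module) module_span_insertE:
  assumes "x \<in> carrier M" "S \<subseteq> carrier M" "y \<in> module_span R M (insert x S)"
  obtains r u where "r \<in> carrier R" "u \<in> module_span R M S" "y = r \<odot>\<^bsub>M\<^esub> x \<oplus>\<^bsub>M\<^esub> u"
proof -
  let ?U = "module_span R M S"
  let ?V = "{r \<odot>\<^bsub>M\<^esub> x \<oplus>\<^bsub>M\<^esub> u | r u. r \<in> carrier R \<and> u \<in> ?U}"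
  note U = submoduleD[OF submodule_module_span[OF assms(2)]]
  have Uc: "u \<in> carrier M" if "u \<in> ?U" for u using that U(1) by blast
  have "submodule ?V R M"
  proof (rule submoduleI)
    show "?V \<subseteq> carrier M" using assms(1) Uc by (auto simp: smult_closed)
    have "\<zero>\<^bsub>M\<^esub> = \<zero>\<^bsub>R\<^esub> \<odot>\<^bsub>M\<^esub> x \<oplus>\<^bsub>M\<^esub> \<zero>\<^bsub>M\<^esub>" using assms(1) by simp
    then show "\<zero>\<^bsub>M\<^esub> \<in> ?V" using U(2) by blast
    fix y z assume "y \<in> ?V" "z \<in> ?V"
    then obtain r u s v where r: "r \<in> carrier R" "u \<in> ?U" "y = r \<odot>\<^bsub>M\<^esub> x \<oplus>\<^bsub>M\<^esub> u"
      and s: "s \<in> carrier R" "v \<in> ?U" "z = s \<odot>\<^bsub>M\<^esub> x \<oplus>\<^bsub>M\<^esub> v" by auto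
    have "y \<oplus>\<^bsub>M\<^esub> z = (r \<oplus>\<^bsub>R\<^esub> s) \<odot>\<^bsub>M\<^esub> x \<oplus>\<^bsub>M\<^esub> (u \<oplus>\<^bsub>M\<^esub> v)"
      using r s assms(1) Uc by (simp add: smult_l_distr smult_closed M.a_ac)
    then show "y \<oplus>\<^bsub>M\<^esub> z \<in> ?V" using r s U(3) by blast
  next
    fix s y assume s: "s \<in> carrier R" "y \<in> ?V"
    then obtain r u where r: "r \<in> carrier R" "u \<in> ?U" "y = r \<odot>\<^bsub>M\<^esub> x \<oplus>\<^bsub>M\<^esub> u" by auto
    have "s \<odot>\<^bsub>M\<^esub> y = (s \<otimes>\<^bsub>R\<^esub> r) \<odot>\<^bsub>M\<^esub> x \<oplus>\<^bsub>M\<^esub> s \<odot>\<^bsub>M\<^esub> u"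
      using r s(1) assms(1) Uc by (simp add: smult_assoc1 smult_r_distr smult_closed)
    then show "s \<odot>\<^bsub>M\<^esub> y \<in> ?V" using r s(1) U(4) by blast
  qed
  moreover have "x \<in> ?V"
  proof -
    have "x = \<one>\<^bsub>R\<^esub> \<odot>\<^bsub>M\<^esub> x \<oplus>\<^bsub>M\<^esub> \<zero>\<^bsub>M\<^esub>" using assms(1) by (simp add: smult_one)
    then show ?thesis using U(2) by blast
  qed
  moreover have "S \<subseteq> ?V"
  proof
    fix s assume s: "s \<in> S"
    then have "s = \<zero>\<^bsub>R\<^esub> \<odot>\<^bsub>M\<^esub> x \<oplus>\<^bsub>M\<^esub> s" using assms(1,2) by auto
    then show "s \<in> ?V" using s module_span_superset[of S R M] by blast
  qed
  ultimately have "module_span R M (insert x S) \<subseteq> ?V"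
    by (intro module_span_least) auto
  then show thesis using assms(3) that by blast
qed

text \<open>Induction on the number of generators, as for Hilbert's basis theorem. For a submodule \<open>N\<close> of
  \<open>R x + U\<close>, finitely many elements of \<open>N\<close> have coefficients of \<open>x\<close> that generate the ideal of all
  such coefficients. Every element of \<open>N\<close> differs from a combination of these by an element of
  \<open>N \<inter> U\<close>, and \<open>N \<inter> U\<close> is finitely generated by induction.\<close>

lemma (in left_module) noetherian_finitely_spanned:
  assumes "noetherian_ring R" "cring R" "finite S" "S \<subseteq> carrier M"
    and "submodule N R M" "N \<subseteq> module_span R M S"
  shows "\<exists>F. finite F \<and> F \<subseteq> N \<and> N \<subseteq> module_span R M F"
  using assms(3-6)
proof (induction S arbitrary: N rule: finite_induct)
  case (insert x S)
  interpret noetherian_ring R by fact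
  have x: "x \<in> carrier M" and S: "S \<subseteq> carrier M" using insert by auto
  let ?U = "module_span R M S"
  have U: "submodule ?U R M" using S by (rule submodule_module_span)
  obtain F2 where F2: "finite F2" "F2 \<subseteq> N \<inter> ?U" "N \<inter> ?U \<subseteq> module_span R M F2"
    using insert.IH[OF S submodule_Int[OF insert.prems(2) U]] by blast
  let ?I = "\<lambda>T. {r \<in> carrier R. \<exists>u\<in>?U. r \<odot>\<^bsub>M\<^esub> x \<oplus>\<^bsub>M\<^esub> u \<in> T}"
  obtain A where A: "A \<subseteq> carrier R" "finite A" "?I N = genideal R A"
    using finetely_gen[OF ideal_of_leading_coefficients[OF assms(2) insert.prems(2) U x]] by blast
  then have "\<forall>a\<in>A. \<exists>u\<in>?U. a \<odot>\<^bsub>M\<^esub> x \<oplus>\<^bsub>M\<^esub> u \<in> N"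
    using genideal_self[OF A(1)] by blast
  then obtain u where u: "\<And>a. a \<in> A \<Longrightarrow> u a \<in> ?U" "\<And>a. a \<in> A \<Longrightarrow> a \<odot>\<^bsub>M\<^esub> x \<oplus>\<^bsub>M\<^esub> u a \<in> N"
    by metis
  define F where "F = (\<lambda>a. a \<odot>\<^bsub>M\<^esub> x \<oplus>\<^bsub>M\<^esub> u a) ` A \<union> F2"
  have F: "finite F" "F \<subseteq> N" using A(2) F2 u(2) by (auto simp: F_def)
  have Nc: "N \<subseteq> carrier M" using submodule_subset[OF insert.prems(2)] .
  then have T: "submodule (module_span R M F) R M"
    using F(2) by (intro submodule_module_span) blast
  have "A \<subseteq> ?I (module_span R M F)"
  proof
    fix a assume a: "a \<in> A"
    then have "a \<odot>\<^bsub>M\<^esub> x \<oplus>\<^bsub>M\<^esub> u a \<in> module_span R M F"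
      using module_span_superset[of F R M] by (auto simp: F_def)
    then show "a \<in> ?I (module_span R M F)" using a A(1) u(1) by blast
  qed
  then have I: "?I N \<subseteq> ?I (module_span R M F)"
    unfolding A(3) by (intro genideal_minimal ideal_of_leading_coefficients assms(2) T U x)
  have "N \<subseteq> module_span R M F"
  proof
    fix n assume n: "n \<in> N"
    then obtain r v where r: "r \<in> carrier R" "v \<in> ?U" "n = r \<odot>\<^bsub>M\<^esub> x \<oplus>\<^bsub>M\<^esub> v"
      using insert.prems(3) module_span_insertE[OF x S] by blast
    then have "r \<in> ?I N" using n by blast
    then obtain w where w: "w \<in> ?U" "r \<odot>\<^bsub>M\<^esub> x \<oplus>\<^bsub>M\<^esub> w \<in> module_span R M F" using I by blast
    have c: "v \<in> carrier M" "w \<in> carrier M" using r w submodule_subset[OF U] by auto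
    have wN: "r \<odot>\<^bsub>M\<^esub> x \<oplus>\<^bsub>M\<^esub> w \<in> N"
      using w(2) module_span_least[OF insert.prems(2) F(2)] by blast
    have eq: "n \<ominus>\<^bsub>M\<^esub> (r \<odot>\<^bsub>M\<^esub> x \<oplus>\<^bsub>M\<^esub> w) = v \<ominus>\<^bsub>M\<^esub> w"
      using r(1,3) x c by (simp add: a_minus_def smult_closed M.minus_add M.a_ac M.r_neg M.r_neg1)
    have "v \<ominus>\<^bsub>M\<^esub> w \<in> ?U" using r w by (intro submodule_minus[OF U])
    moreover have "v \<ominus>\<^bsub>M\<^esub> w \<in> N"
      unfolding eq[symmetric] using n wN by (intro submodule_minus[OF insert.prems(2)])
    ultimately have "v \<ominus>\<^bsub>M\<^esub> w \<in> module_span R M F"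
      using F2(3) module_span_mono[of F2 F R M] by (auto simp: F_def)
    then have "(r \<odot>\<^bsub>M\<^esub> x \<oplus>\<^bsub>M\<^esub> w) \<oplus>\<^bsub>M\<^esub> (v \<ominus>\<^bsub>M\<^esub> w) \<in> module_span R M F"
      using w(2) submodule_add[OF T] by blast
    then show "n \<in> module_span R M F"
      using r x c by (simp add: a_minus_def smult_closed M.a_assoc M.a_comm[of v] M.r_neg2)
  qed
  then show ?case using F by blast
qed auto

definition restrict_scalars :: "('k \<Rightarrow> 'r) \<Rightarrow> ('r, 'a, 'y) module_scheme \<Rightarrow> ('k, 'a) module" where
  "restrict_scalars \<phi> M =
     \<lparr>carrier = carrier M, monoid.mult = undefined, monoid.one = undefined, zero = \<zero>\<^bsub>M\<^esub>, add = add M,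
      smult = \<lambda>r x. \<phi> r \<odot>\<^bsub>M\<^esub> x\<rparr>"

context artin_algebra
begin

lemma structure_map_simps [simp]:
  "r \<in> carrier R \<Longrightarrow> \<phi> r \<in> carrier L"
  "\<lbrakk>r \<in> carrier R; s \<in> carrier R\<rbrakk> \<Longrightarrow> \<phi> (r \<oplus>\<^bsub>R\<^esub> s) = \<phi> r \<oplus>\<^bsub>L\<^esub> \<phi> s"
  "\<lbrakk>r \<in> carrier R; s \<in> carrier R\<rbrakk> \<Longrightarrow> \<phi> (r \<otimes>\<^bsub>R\<^esub> s) = \<phi> r \<otimes>\<^bsub>L\<^esub> \<phi> s"
  "\<phi> \<one>\<^bsub>R\<^esub> = \<one>\<^bsub>L\<^esub>"
  using structure_map
  by (auto simp: ring_hom_closed ring_hom_add ring_hom_mult ring_hom_one)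

lemma left_module_restrict_scalars:
  assumes "left_module L M"
  shows "left_module R (restrict_scalars \<phi> M)"
proof -
  interpret M: left_module L M by fact
  have "abelian_group (restrict_scalars \<phi> M)"
  proof (rule abelian_groupI)
    fix x assume "x \<in> carrier (restrict_scalars \<phi> M)"
    then show "\<exists>y\<in>carrier (restrict_scalars \<phi> M).
        y \<oplus>\<^bsub>restrict_scalars \<phi> M\<^esub> x = \<zero>\<^bsub>restrict_scalars \<phi> M\<^esub>"
      by (auto simp: restrict_scalars_def M.M.l_neg intro!: bexI[of _ "\<ominus>\<^bsub>M\<^esub> x"])
  qed (auto simp: restrict_scalars_def M.M.a_ac)
  then show ?thesis
    by (intro left_module.intro left_module_axioms.intro R.ring_axioms)
      (auto simp: restrict_scalars_def M.smult_closed M.smult_l_distr M.smult_r_distr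
        M.smult_assoc1 M.smult_one)
qed

lemma submodule_restrict_scalars:
  assumes "left_module L M" "submodule N L M"
  shows "submodule N R (restrict_scalars \<phi> M)"
proof -
  interpret M': left_module R "restrict_scalars \<phi> M"
    using assms(1) by (rule left_module_restrict_scalars)
  show ?thesis
    using submoduleD[OF assms(2)] by (intro M'.submoduleI) (auto simp: restrict_scalars_def)
qed

text \<open>If \<open>T\<close> generates the algebra over \<open>R\<close> and \<open>S\<close> generates the module over the algebra, the
  products \<open>t s\<close> generate the module over \<open>R\<close>.\<close>

lemma fg_module_restrict_scalars:
  assumes "fg_module L M"
  shows "fg_module R (restrict_scalars \<phi> M)"
proof -
  interpret M: fg_module L M by fact
  obtain T where T: "finite T" "T \<subseteq> carrier L"
    "\<And>l. l \<in> carrier L \<Longrightarrow> \<exists>a \<in> T \<rightarrow> carrier R. l = (\<Oplus>\<^bsub>L\<^esub>t \<in> T. \<phi> (a t) \<otimes>\<^bsub>L\<^esub> t)"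
    using finitely_generated by blast
  obtain S where S: "finite S" "S \<subseteq> carrier M"
    "\<And>x. x \<in> carrier M \<Longrightarrow> \<exists>a \<in> S \<rightarrow> carrier L. x = (\<Oplus>\<^bsub>M\<^esub>s \<in> S. a s \<odot>\<^bsub>M\<^esub> s)"
    using M.finitely_generated by blast
  show ?thesis
  proof (rule fg_moduleI[OF left_module_restrict_scalars[OF M.left_module_axioms]])
    show "finite ((\<lambda>(t, s). t \<odot>\<^bsub>M\<^esub> s) ` (T \<times> S))" using S(1) T(1) by simp
    show "(\<lambda>(t, s). t \<odot>\<^bsub>M\<^esub> s) ` (T \<times> S) \<subseteq> carrier (restrict_scalars \<phi> M)"
      using S(2) T(2) by (auto simp: restrict_scalars_def subset_iff intro!: M.smult_closed)
    fix N assume N: "submodule N R (restrict_scalars \<phi> M)"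
      and sub: "(\<lambda>(t, s). t \<odot>\<^bsub>M\<^esub> s) ` (T \<times> S) \<subseteq> N"
    have Nc: "N \<subseteq> carrier M" and N0: "\<zero>\<^bsub>M\<^esub> \<in> N"
      and Na: "\<And>x y. \<lbrakk>x \<in> N; y \<in> N\<rbrakk> \<Longrightarrow> x \<oplus>\<^bsub>M\<^esub> y \<in> N"
      and Ns: "\<And>r x. \<lbrakk>r \<in> carrier R; x \<in> N\<rbrakk> \<Longrightarrow> \<phi> r \<odot>\<^bsub>M\<^esub> x \<in> N"
      using submoduleD[OF N] by (simp_all add: restrict_scalars_def)
    have LS: "l \<odot>\<^bsub>M\<^esub> s \<in> N" if l: "l \<in> carrier L" and s: "s \<in> S" for l s
    proof -
      have sc: "s \<in> carrier M" using s S(2) by blast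
      obtain a where a: "a \<in> T \<rightarrow> carrier R" "l = (\<Oplus>\<^bsub>L\<^esub>t \<in> T. \<phi> (a t) \<otimes>\<^bsub>L\<^esub> t)"
        using T(3)[OF l] by blast
      have "(\<Oplus>\<^bsub>L\<^esub>t \<in> T. \<phi> (a t) \<otimes>\<^bsub>L\<^esub> t) \<in> {l \<in> carrier L. l \<odot>\<^bsub>M\<^esub> s \<in> N}"
      proof (rule L.finsum_mem)
        fix t assume t: "t \<in> T"
        then have "\<phi> (a t) \<odot>\<^bsub>M\<^esub> (t \<odot>\<^bsub>M\<^esub> s) \<in> N" using a(1) sub s by (intro Ns) auto
        moreover have "a t \<in> carrier R" "t \<in> carrier L" using t a(1) T(2) by auto
        ultimately show "\<phi> (a t) \<otimes>\<^bsub>L\<^esub> t \<in> {l \<in> carrier L. l \<odot>\<^bsub>M\<^esub> s \<in> N}"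
          using sc by (simp add: M.smult_assoc1)
      qed (use sc N0 Na in \<open>auto simp: M.smult_l_distr\<close>)
      then show ?thesis using a(2) by simp
    qed
    show "carrier (restrict_scalars \<phi> M) \<subseteq> N"
    proof
      fix x assume "x \<in> carrier (restrict_scalars \<phi> M)"
      then obtain a where a: "a \<in> S \<rightarrow> carrier L" "x = (\<Oplus>\<^bsub>M\<^esub>s \<in> S. a s \<odot>\<^bsub>M\<^esub> s)"
        using S(3)[of x] by (auto simp: restrict_scalars_def)
      show "x \<in> N"
        unfolding a(2) using Nc N0 Na LS a(1) by (intro M.M.finsum_mem) (auto simp: Pi_iff)
    qed
  qed
qed

text \<open>Over the noetherian ring \<open>R\<close> a submodule over the algebra has finitely many generators, and
  these generate it all the more over the algebra.\<close>

theorem fg_submodule: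
  assumes "fg_module L M" "submodule N L M"
  shows "fg_module L (M\<lparr>carrier := N\<rparr>)"
proof -
  interpret M: fg_module L M by fact
  interpret M': fg_module R "restrict_scalars \<phi> M"
    using assms(1) by (rule fg_module_restrict_scalars)
  obtain S where S: "finite S" "S \<subseteq> carrier (restrict_scalars \<phi> M)"
    "\<And>N. \<lbrakk>submodule N R (restrict_scalars \<phi> M); S \<subseteq> N\<rbrakk> \<Longrightarrow>
       carrier (restrict_scalars \<phi> M) \<subseteq> N"
    using fg_moduleE[OF M'.fg_module_axioms] by blast
  have "carrier (restrict_scalars \<phi> M) \<subseteq> module_span R (restrict_scalars \<phi> M) S"
    using S(3)[OF M'.submodule_module_span[OF S(2)] module_span_superset] .
  moreover have N: "submodule N R (restrict_scalars \<phi> M)"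
    using M.left_module_axioms assms(2) by (rule submodule_restrict_scalars)
  ultimately obtain F where F: "finite F" "F \<subseteq> N" "N \<subseteq> module_span R (restrict_scalars \<phi> M) F"
    using M'.noetherian_finitely_spanned[OF artinian_imp_noetherian R.is_cring S(1,2) N]
      submodule_subset[OF N] by blast
  have "submodule (module_span L M F) L M"
    using F(2) submodule_subset[OF assms(2)] by (intro M.submodule_module_span) blast
  then have "module_span R (restrict_scalars \<phi> M) F \<subseteq> module_span L M F"
    by (intro module_span_least submodule_restrict_scalars M.left_module_axioms
        module_span_superset)
  then show ?thesis
    using F by (intro M.fg_submoduleI[OF assms(2) F(1,2)]) blast
qed

end

section \<open>Homomorphisms, kernels and cokernels\<close>

lemma lmod_homI:
  assumes "\<And>x. x \<in> carrier M \<Longrightarrow> f x \<in> carrier N"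
    and "\<And>x y. \<lbrakk>x \<in> carrier M; y \<in> carrier M\<rbrakk> \<Longrightarrow> f (x \<oplus>\<^bsub>M\<^esub> y) = f x \<oplus>\<^bsub>N\<^esub> f y"
    and "\<And>r x. \<lbrakk>r \<in> carrier R; x \<in> carrier M\<rbrakk> \<Longrightarrow> f (r \<odot>\<^bsub>M\<^esub> x) = r \<odot>\<^bsub>N\<^esub> f x"
  shows "f \<in> lmod_hom R M N"
  using assms unfolding lmod_hom_def by auto

lemma lmod_homD:
  assumes "f \<in> lmod_hom R M N"
  shows lmod_hom_closed: "x \<in> carrier M \<Longrightarrow> f x \<in> carrier N"
    and lmod_hom_add: "\<lbrakk>x \<in> carrier M; y \<in> carrier M\<rbrakk> \<Longrightarrow> f (x \<oplus>\<^bsub>M\<^esub> y) = f x \<oplus>\<^bsub>N\<^esub> f y"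
    and lmod_hom_smult: "\<lbrakk>r \<in> carrier R; x \<in> carrier M\<rbrakk> \<Longrightarrow> f (r \<odot>\<^bsub>M\<^esub> x) = r \<odot>\<^bsub>N\<^esub> f x"
  using assms unfolding lmod_hom_def by auto

lemma lmod_hom_comp:
  assumes f: "f \<in> lmod_hom R A B" and g: "g \<in> lmod_hom R B C"
  shows "(\<lambda>x. g (f x)) \<in> lmod_hom R A C"
  by (rule lmod_homI) (simp_all add: lmod_homD[OF f] lmod_homD[OF g])

lemma lmod_hom_id: "(\<lambda>x. x) \<in> lmod_hom R A A"
  by (rule lmod_homI) simp_all

lemma lmod_hom_zero:
  assumes "left_module R M" "left_module R N" "f \<in> lmod_hom R M N"
  shows "f \<zero>\<^bsub>M\<^esub> = \<zero>\<^bsub>N\<^esub>"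
proof -
  interpret M: left_module R M by fact
  interpret N: left_module R N by fact
  have "f (\<zero>\<^bsub>R\<^esub> \<odot>\<^bsub>M\<^esub> \<zero>\<^bsub>M\<^esub>) = \<zero>\<^bsub>R\<^esub> \<odot>\<^bsub>N\<^esub> f \<zero>\<^bsub>M\<^esub>"
    using assms(3) by (rule lmod_hom_smult) simp_all
  then show ?thesis using lmod_hom_closed[OF assms(3)] by simp
qed

lemma lmod_hom_minus:
  assumes M: "left_module R M" and N: "left_module R N" and f: "f \<in> lmod_hom R M N"
    and x: "x \<in> carrier M" "y \<in> carrier M"
  shows "f (x \<ominus>\<^bsub>M\<^esub> y) = f x \<ominus>\<^bsub>N\<^esub> f y"
proof -
  interpret M: left_module R M by fact
  interpret N: left_module R N by fact
  have "f ((\<ominus>\<^bsub>R\<^esub> \<one>\<^bsub>R\<^esub>) \<odot>\<^bsub>M\<^esub> y) = (\<ominus>\<^bsub>R\<^esub> \<one>\<^bsub>R\<^esub>) \<odot>\<^bsub>N\<^esub> f y"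
    using f by (rule lmod_hom_smult) (simp_all add: x)
  then have "f (\<ominus>\<^bsub>M\<^esub> y) = \<ominus>\<^bsub>N\<^esub> f y"
    using x lmod_hom_closed[OF f] by (simp add: M.smult_minus_one N.smult_minus_one)
  then show ?thesis
    using x by (simp add: a_minus_def lmod_hom_add[OF f])
qed

lemma splittable_epiI:
  assumes "f \<in> lmod_hom R M N" "s \<in> lmod_hom R N M" "\<And>y. y \<in> carrier N \<Longrightarrow> f (s y) = y"
  shows "splittable_epi R M N f"
  unfolding splittable_epi_def using assms by (intro conjI bexI[of _ s] ballI)

lemma splittable_monoI:
  assumes "f \<in> lmod_hom R M N" "t \<in> lmod_hom R N M" "\<And>x. x \<in> carrier M \<Longrightarrow> t (f x) = x"
  shows "splittable_mono R M N f"
  unfolding splittable_mono_def using assms by (intro conjI bexI[of _ t] ballI)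

lemma (in left_module) smult_minus:
  assumes r: "r \<in> carrier R" and x: "x \<in> carrier M" "y \<in> carrier M"
  shows "r \<odot>\<^bsub>M\<^esub> (x \<ominus>\<^bsub>M\<^esub> y) = r \<odot>\<^bsub>M\<^esub> x \<ominus>\<^bsub>M\<^esub> r \<odot>\<^bsub>M\<^esub> y"
proof -
  have "r \<odot>\<^bsub>M\<^esub> (\<ominus>\<^bsub>M\<^esub> y) \<oplus>\<^bsub>M\<^esub> r \<odot>\<^bsub>M\<^esub> y = \<zero>\<^bsub>M\<^esub>"
    using r x smult_r_distr[of r "\<ominus>\<^bsub>M\<^esub> y" y] by (simp add: M.l_neg)
  then have "r \<odot>\<^bsub>M\<^esub> (\<ominus>\<^bsub>M\<^esub> y) = \<ominus>\<^bsub>M\<^esub> (r \<odot>\<^bsub>M\<^esub> y)"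
    using r x by (intro M.minus_equality[symmetric]) (simp_all add: smult_closed)
  then show ?thesis
    using r x by (simp add: a_minus_def smult_r_distr)
qed

lemma submodule_kernel:
  assumes M: "left_module R M" and N: "left_module R N" and f: "f \<in> lmod_hom R M N"
  shows "submodule (a_kernel M N f) R M"
proof -
  interpret M: left_module R M by fact
  interpret N: left_module R N by fact
  show ?thesis
    by (rule M.submoduleI)
      (simp_all add: a_kernel_def' subset_iff lmod_homD(2,3)[OF f] lmod_hom_zero[OF M N f]
        M.smult_closed)
qed

lemma submodule_image:
  assumes M: "left_module R M" and N: "left_module R N" and f: "f \<in> lmod_hom R M N"
  shows "submodule (f ` carrier M) R N"
proof -
  interpret M: left_module R M by fact
  interpret N: left_module R N by fact
  show ?thesis
  proof (rule N.submoduleI)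
    show "f ` carrier M \<subseteq> carrier N" using lmod_hom_closed[OF f] by blast
    show "\<zero>\<^bsub>N\<^esub> \<in> f ` carrier M"
      unfolding lmod_hom_zero[OF M N f, symmetric] by simp
    show "x \<oplus>\<^bsub>N\<^esub> y \<in> f ` carrier M" if "x \<in> f ` carrier M" "y \<in> f ` carrier M" for x y
      using that by (auto simp flip: lmod_hom_add[OF f])
    show "r \<odot>\<^bsub>N\<^esub> y \<in> f ` carrier M" if "r \<in> carrier R" "y \<in> f ` carrier M" for r y
      using that by (auto simp flip: lmod_hom_smult[OF f] simp: M.smult_closed)
  qed
qed

lemma (in left_module) submodule_abelian_subgroup:
  assumes K: "submodule K R M"
  shows "abelian_subgroup K M"
  using submodule.axioms(1)[OF K]
  by (intro abelian_subgroupI3 additive_subgroupI M.abelian_group_axioms)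

lemma (in left_module) coset_eq_iff:
  assumes K: "submodule K R M" and "x \<in> carrier M" "y \<in> carrier M"
  shows "K +>\<^bsub>M\<^esub> x = K +>\<^bsub>M\<^esub> y \<longleftrightarrow> x \<ominus>\<^bsub>M\<^esub> y \<in> K"
proof -
  interpret K: abelian_subgroup K M
    using K by (rule submodule_abelian_subgroup)
  show ?thesis
    using K.a_rcos_module[OF assms(3,2)] K.a_repr_independence'[OF _ assms(3), of x]
      K.a_rcos_self[OF assms(2)]
    unfolding a_minus_def by metis
qed

text \<open>The scalar multiplication of a quotient module and the induced map of cokernels are defined as
  unions over all representatives of a coset. This lemma evaluates such a union at a single
  representative, once independence of the representative is known.\<close>

lemma (in left_module) UN_coset_const:
  assumes K: "submodule K R M" and x: "x \<in> carrier M"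
    and "\<And>y. \<lbrakk>y \<in> carrier M; y \<ominus>\<^bsub>M\<^esub> x \<in> K\<rbrakk> \<Longrightarrow> F y = F x"
  shows "(\<Union>y \<in> K +>\<^bsub>M\<^esub> x. F y) = F x"
proof -
  interpret K: abelian_subgroup K M using K by (rule submodule_abelian_subgroup)
  show ?thesis
  proof (rule SUP_eq_const)
    show "K +>\<^bsub>M\<^esub> x \<noteq> {}" using K.a_rcos_self[OF x] by blast
    fix y assume y: "y \<in> K +>\<^bsub>M\<^esub> x"
    show "F y = F x"
      using K.a_elemrcos_carrier[OF x y] K.a_rcos_module_imp[OF x y]
      by (intro assms(3)) (simp_all add: a_minus_def)
  qed
qed

lemma quotient_module_simps:
  assumes "left_module R M" and K: "submodule K R M"
  shows quotient_carrier: "carrier (quotient_module M K) = (\<lambda>x. K +>\<^bsub>M\<^esub> x) ` carrier M"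
    and quotient_zero: "\<zero>\<^bsub>quotient_module M K\<^esub> = K +>\<^bsub>M\<^esub> \<zero>\<^bsub>M\<^esub>"
    and quotient_add: "\<lbrakk>x \<in> carrier M; y \<in> carrier M\<rbrakk> \<Longrightarrow>
      (K +>\<^bsub>M\<^esub> x) \<oplus>\<^bsub>quotient_module M K\<^esub> (K +>\<^bsub>M\<^esub> y) = K +>\<^bsub>M\<^esub> (x \<oplus>\<^bsub>M\<^esub> y)"
    and quotient_smult: "\<lbrakk>r \<in> carrier R; x \<in> carrier M\<rbrakk> \<Longrightarrow>
      r \<odot>\<^bsub>quotient_module M K\<^esub> (K +>\<^bsub>M\<^esub> x) = K +>\<^bsub>M\<^esub> (r \<odot>\<^bsub>M\<^esub> x)"
proof -
  interpret left_module R M by fact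
  interpret K: abelian_subgroup K M using K by (rule submodule_abelian_subgroup)
  show "carrier (quotient_module M K) = (\<lambda>x. K +>\<^bsub>M\<^esub> x) ` carrier M"
    by (auto simp: quotient_module_def A_RCOSETS_def')
  show "\<zero>\<^bsub>quotient_module M K\<^esub> = K +>\<^bsub>M\<^esub> \<zero>\<^bsub>M\<^esub>"
    by (simp add: quotient_module_def K.a_rcos_const)
  show "(K +>\<^bsub>M\<^esub> x) \<oplus>\<^bsub>quotient_module M K\<^esub> (K +>\<^bsub>M\<^esub> y) = K +>\<^bsub>M\<^esub> (x \<oplus>\<^bsub>M\<^esub> y)"
    if "x \<in> carrier M" "y \<in> carrier M"
    using that by (simp add: quotient_module_def K.a_rcos_sum)
  show "r \<odot>\<^bsub>quotient_module M K\<^esub> (K +>\<^bsub>M\<^esub> x) = K +>\<^bsub>M\<^esub> (r \<odot>\<^bsub>M\<^esub> x)"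
    if r: "r \<in> carrier R" and x: "x \<in> carrier M"
  proof -
    have "(\<Union>y \<in> K +>\<^bsub>M\<^esub> x. K +>\<^bsub>M\<^esub> (r \<odot>\<^bsub>M\<^esub> y)) = K +>\<^bsub>M\<^esub> (r \<odot>\<^bsub>M\<^esub> x)"
    proof (rule UN_coset_const[OF K x])
      fix y assume y: "y \<in> carrier M" "y \<ominus>\<^bsub>M\<^esub> x \<in> K"
      have "r \<odot>\<^bsub>M\<^esub> (y \<ominus>\<^bsub>M\<^esub> x) \<in> K" using r y(2) by (rule submodule_smult[OF K])
      then have "r \<odot>\<^bsub>M\<^esub> y \<ominus>\<^bsub>M\<^esub> r \<odot>\<^bsub>M\<^esub> x \<in> K"
        using r x y(1) by (simp add: smult_minus)
      then show "K +>\<^bsub>M\<^esub> (r \<odot>\<^bsub>M\<^esub> y) = K +>\<^bsub>M\<^esub> (r \<odot>\<^bsub>M\<^esub> x)"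
        using r x y(1) by (subst coset_eq_iff[OF K]) (simp_all add: smult_closed)
    qed
    then show ?thesis by (simp add: quotient_module_def)
  qed
qed

lemma coker_map_coset:
  assumes N: "left_module R N" and N': "left_module R N'" and M': "left_module R M'"
    and K: "submodule K R N" and f': "f' \<in> lmod_hom R M' N'" and u: "u \<in> lmod_hom R N N'"
    and sub: "u ` K \<subseteq> f' ` carrier M'" and x: "x \<in> carrier N"
  shows "coker_map M' N' f' u (K +>\<^bsub>N\<^esub> x) = (f' ` carrier M') +>\<^bsub>N'\<^esub> u x"
  unfolding coker_map_def
proof (rule left_module.UN_coset_const[OF N K x])
  fix y assume y: "y \<in> carrier N" "y \<ominus>\<^bsub>N\<^esub> x \<in> K"
  then have "u (y \<ominus>\<^bsub>N\<^esub> x) \<in> f' ` carrier M'" using sub by blast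
  then have "u y \<ominus>\<^bsub>N'\<^esub> u x \<in> f' ` carrier M'"
    unfolding lmod_hom_minus[OF N N' u y(1) x] .
  then show "(f' ` carrier M') +>\<^bsub>N'\<^esub> u y = (f' ` carrier M') +>\<^bsub>N'\<^esub> u x"
    using lmod_hom_closed[OF u] x y
    by (subst left_module.coset_eq_iff[OF N' submodule_image[OF M' N' f']]) auto
qed

lemma fg_quotient_module:
  assumes M: "fg_module R M" and K: "submodule K R M"
  shows "fg_module R (quotient_module M K)"
proof (rule fg_module_image[OF M])
  note Q = quotient_module_simps[OF fg_module_imp_left_module[OF M] K]
  show "carrier (quotient_module M K) = (\<lambda>x. K +>\<^bsub>M\<^esub> x) ` carrier M"
    "\<zero>\<^bsub>quotient_module M K\<^esub> = K +>\<^bsub>M\<^esub> \<zero>\<^bsub>M\<^esub>" by (fact Q)+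
qed (rule quotient_module_simps[OF fg_module_imp_left_module[OF M] K]; assumption)+

lemma quotient_projection_hom:
  assumes "left_module R M" "submodule K R M"
  shows "(\<lambda>x. K +>\<^bsub>M\<^esub> x) \<in> lmod_hom R M (quotient_module M K)"
  by (rule lmod_homI) (simp_all add: quotient_module_simps[OF assms])

text \<open>The value of the induced map is computed at a representative chosen arbitrarily in each
  coset.\<close>

lemma quotient_hom_lift:
  assumes M: "left_module R M" and A: "left_module R A" and K: "submodule K R M"
    and v: "v \<in> lmod_hom R M A" "\<And>x. x \<in> K \<Longrightarrow> v x = \<zero>\<^bsub>A\<^esub>"
  obtains t where "t \<in> lmod_hom R (quotient_module M K) A"
    "\<And>x. x \<in> carrier M \<Longrightarrow> t (K +>\<^bsub>M\<^esub> x) = v x"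
proof -
  interpret M: left_module R M by fact
  interpret A: left_module R A by fact
  define t where "t C = v (SOME x. x \<in> carrier M \<and> K +>\<^bsub>M\<^esub> x = C)" for C
  have t: "t (K +>\<^bsub>M\<^esub> x) = v x" if x: "x \<in> carrier M" for x
  proof -
    define y where "y = (SOME y. y \<in> carrier M \<and> K +>\<^bsub>M\<^esub> y = K +>\<^bsub>M\<^esub> x)"
    have y: "y \<in> carrier M" "K +>\<^bsub>M\<^esub> y = K +>\<^bsub>M\<^esub> x"
      using someI[of "\<lambda>y. y \<in> carrier M \<and> K +>\<^bsub>M\<^esub> y = K +>\<^bsub>M\<^esub> x" x] x by (simp_all add: y_def)
    then have "v (y \<ominus>\<^bsub>M\<^esub> x) = \<zero>\<^bsub>A\<^esub>"
      using v(2) M.coset_eq_iff[OF K y(1) x] by blast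
    then have "v y \<ominus>\<^bsub>A\<^esub> v x = \<zero>\<^bsub>A\<^esub>"
      unfolding lmod_hom_minus[OF M A v(1) y(1) x] .
    then have "v y = v x"
      using lmod_hom_closed[OF v(1) x] lmod_hom_closed[OF v(1) y(1)]
      by (metis a_minus_def A.M.minus_equality A.M.minus_minus A.M.a_inv_closed)
    then show ?thesis by (simp add: t_def y_def)
  qed
  note Q = quotient_module_simps[OF M K]
  have "t \<in> lmod_hom R (quotient_module M K) A"
    by (rule lmod_homI) (auto simp: Q t lmod_homD[OF v(1)] M.smult_closed)
  then show thesis using t that by blast
qed


section \<open>Short exact sequences\<close>

lemma (in abelian_group) minus_minus_swap:
  assumes "a \<in> carrier G" "b \<in> carrier G" "c \<in> carrier G" "d \<in> carrier G" "a \<ominus> b = c \<ominus> d"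
  shows "d \<ominus> b = c \<ominus> a"
proof -
  have "d \<ominus> b = (d \<ominus> a) \<oplus> (a \<ominus> b)"
    using assms(1-4) by (simp add: a_minus_def a_assoc r_neg1)
  also have "\<dots> = (d \<ominus> a) \<oplus> (c \<ominus> d)" by (simp add: assms(5))
  also have "\<dots> = (c \<ominus> a) \<oplus> (d \<ominus> d)"
    using assms(1-4) by (simp add: a_minus_def a_ac)
  also have "\<dots> = c \<ominus> a"
    using assms(1-4) by (simp add: a_minus_def r_neg)
  finally show ?thesis .
qed

text \<open>If \<open>t\<close> is a retraction of \<open>j\<close>, then \<open>x - j (t x)\<close> depends only on \<open>p x\<close>, and sending
  \<open>p x\<close> to it is a section of \<open>p\<close>.\<close>

lemma short_exact_retraction_imp_section:
  assumes ex: "short_exact R A j B p C" and mono: "splittable_mono R A B j"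
  shows "splittable_epi R B C p"
proof -
  have A: "left_module R A" and B: "left_module R B" and C: "left_module R C"
    and j: "j \<in> lmod_hom R A B" and p: "p \<in> lmod_hom R B C"
    and im: "j ` carrier A = a_kernel B C p" and surj: "p ` carrier B = carrier C"
    using ex fg_module_imp_left_module by (auto simp: short_exact_def)
  interpret A: left_module R A by (fact A)
  interpret B: left_module R B by (fact B)
  interpret C: left_module R C by (fact C)
  obtain t where t: "t \<in> lmod_hom R B A" "\<And>x. x \<in> carrier A \<Longrightarrow> t (j x) = x"
    using mono by (auto simp: splittable_mono_def)
  have jt: "(\<lambda>x. j (t x)) \<in> lmod_hom R B B" using t(1) j by (rule lmod_hom_comp)
  note jt_closed = lmod_hom_closed[OF jt]
  define s where "s c = (let x = inv_into (carrier B) p c in x \<ominus>\<^bsub>B\<^esub> j (t x))" for c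
  have sp: "s (p x) = x \<ominus>\<^bsub>B\<^esub> j (t x)" if x: "x \<in> carrier B" for x
  proof -
    define y where "y = inv_into (carrier B) p (p x)"
    have y: "y \<in> carrier B" "p y = p x"
      using x by (auto simp: y_def inv_into_into f_inv_into_f)
    have "p (x \<ominus>\<^bsub>B\<^esub> y) = p x \<ominus>\<^bsub>C\<^esub> p y"
      using B C p x y(1) by (rule lmod_hom_minus)
    then have "p (x \<ominus>\<^bsub>B\<^esub> y) = \<zero>\<^bsub>C\<^esub>"
      using x y(2) lmod_hom_closed[OF p x] by (simp add: a_minus_def C.M.r_neg)
    then have "x \<ominus>\<^bsub>B\<^esub> y \<in> j ` carrier A"
      unfolding im a_kernel_def' using x y by simp
    then have fixed: "j (t (x \<ominus>\<^bsub>B\<^esub> y)) = x \<ominus>\<^bsub>B\<^esub> y" using t(2) by auto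
    have "j (t x) \<ominus>\<^bsub>B\<^esub> j (t y) = x \<ominus>\<^bsub>B\<^esub> y"
      using fixed x y(1) lmod_hom_minus[OF B B jt] by simp
    then have "y \<ominus>\<^bsub>B\<^esub> j (t y) = x \<ominus>\<^bsub>B\<^esub> j (t x)"
      using x y(1) by (intro B.M.minus_minus_swap[OF jt_closed jt_closed])
    then show ?thesis by (simp add: s_def Let_def flip: y_def)
  qed
  have "s \<in> lmod_hom R C B"
  proof (rule lmod_homI)
    fix c assume "c \<in> carrier C"
    then obtain x where x: "x \<in> carrier B" "c = p x" using surj by auto
    then show "s c \<in> carrier B" using jt_closed by (simp add: sp)
    { fix r assume r: "r \<in> carrier R"
      have "s (r \<odot>\<^bsub>C\<^esub> c) = s (p (r \<odot>\<^bsub>B\<^esub> x))"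
        using x r by (simp add: lmod_hom_smult[OF p])
      also have "\<dots> = r \<odot>\<^bsub>B\<^esub> x \<ominus>\<^bsub>B\<^esub> r \<odot>\<^bsub>B\<^esub> j (t x)"
        using x r by (simp add: sp B.smult_closed lmod_hom_smult[OF jt])
      also have "\<dots> = r \<odot>\<^bsub>B\<^esub> s c"
        using x r jt_closed by (simp add: sp B.smult_minus)
      finally show "s (r \<odot>\<^bsub>C\<^esub> c) = r \<odot>\<^bsub>B\<^esub> s c" . }
    fix d assume "d \<in> carrier C"
    then obtain y where y: "y \<in> carrier B" "d = p y" using surj by auto
    have "s (c \<oplus>\<^bsub>C\<^esub> d) = s (p (x \<oplus>\<^bsub>B\<^esub> y))"
      using x y by (simp add: lmod_hom_add[OF p])
    also have "\<dots> = (x \<oplus>\<^bsub>B\<^esub> y) \<ominus>\<^bsub>B\<^esub> (j (t x) \<oplus>\<^bsub>B\<^esub> j (t y))"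
      using x y by (simp add: sp lmod_hom_add[OF jt])
    also have "\<dots> = s c \<oplus>\<^bsub>B\<^esub> s d"
      using x y jt_closed by (simp add: sp a_minus_def B.M.minus_add B.M.a_ac)
    finally show "s (c \<oplus>\<^bsub>C\<^esub> d) = s c \<oplus>\<^bsub>B\<^esub> s d" .
  qed
  moreover have "p (s c) = c" if "c \<in> carrier C" for c
  proof -
    have "c \<in> p ` carrier B" using that surj by simp
    then obtain x where x: "x \<in> carrier B" "c = p x" by blast
    have "j (t x) \<in> a_kernel B C p"
      unfolding im[symmetric] using x lmod_hom_closed[OF t(1)] by blast
    then have "p (j (t x)) = \<zero>\<^bsub>C\<^esub>" by (simp add: a_kernel_def')
    moreover have "p (x \<ominus>\<^bsub>B\<^esub> j (t x)) = p x \<ominus>\<^bsub>C\<^esub> p (j (t x))"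
      using B C p x(1) jt_closed[OF x(1)] by (rule lmod_hom_minus)
    ultimately show ?thesis
      using x lmod_hom_closed[OF p x(1)]
      by (simp add: sp a_minus_def C.M.minus_equality[of "\<zero>\<^bsub>C\<^esub>" "\<zero>\<^bsub>C\<^esub>"])
  qed
  ultimately show ?thesis using p by (auto simp: splittable_epi_def)
qed

text \<open>A morphism \<open>(g, h, f)\<close> between two short exact sequences.\<close>

locale short_exact_rows =
  fixes R :: "('r, 'y) ring_scheme"
    and N1 :: "('r, 'n1) module" and N2 :: "('r, 'n2) module" and g :: "'n1 \<Rightarrow> 'n2"
    and E1 :: "('r, 'e1) module" and E2 :: "('r, 'e2) module" and h :: "'e1 \<Rightarrow> 'e2"
    and M1 :: "('r, 'm1) module" and M2 :: "('r, 'm2) module" and f :: "'m1 \<Rightarrow> 'm2"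
    and j1 :: "'n1 \<Rightarrow> 'e1" and j2 :: "'n2 \<Rightarrow> 'e2"
    and p1 :: "'e1 \<Rightarrow> 'm1" and p2 :: "'e2 \<Rightarrow> 'm2"
  assumes row1: "short_exact R N1 j1 E1 p1 M1" and row2: "short_exact R N2 j2 E2 p2 M2"
    and g: "g \<in> lmod_hom R N1 N2" and h: "h \<in> lmod_hom R E1 E2" and f: "f \<in> lmod_hom R M1 M2"
    and comm_j: "x \<in> carrier N1 \<Longrightarrow> h (j1 x) = j2 (g x)"
    and comm_p: "y \<in> carrier E1 \<Longrightarrow> f (p1 y) = p2 (h y)"
begin

lemma fg_modules:
  "fg_module R N1" "fg_module R E1" "fg_module R M1"
  "fg_module R N2" "fg_module R E2" "fg_module R M2"
  using row1 row2 by (simp_all add: short_exact_def)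

lemmas left_modules = fg_modules[THEN fg_module_imp_left_module]

sublocale N1: left_module R N1 by (fact left_modules)
sublocale E1: left_module R E1 by (fact left_modules)
sublocale M1: left_module R M1 by (fact left_modules)
sublocale N2: left_module R N2 by (fact left_modules)
sublocale E2: left_module R E2 by (fact left_modules)
sublocale M2: left_module R M2 by (fact left_modules)

lemma row_homs:
  "j1 \<in> lmod_hom R N1 E1" "p1 \<in> lmod_hom R E1 M1" "j2 \<in> lmod_hom R N2 E2" "p2 \<in> lmod_hom R E2 M2"
  using row1 row2 by (simp_all add: short_exact_def)

lemmas j1_closed [simp] = lmod_hom_closed[OF row_homs(1)]
lemmas p1_closed [simp] = lmod_hom_closed[OF row_homs(2)]
lemmas j2_closed [simp] = lmod_hom_closed[OF row_homs(3)]
lemmas p2_closed [simp] = lmod_hom_closed[OF row_homs(4)]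
lemmas g_closed [simp] = lmod_hom_closed[OF g]
lemmas h_closed [simp] = lmod_hom_closed[OF h]
lemmas f_closed [simp] = lmod_hom_closed[OF f]

lemma exact1: "\<lbrakk>x \<in> carrier E1; p1 x = \<zero>\<^bsub>M1\<^esub>\<rbrakk> \<Longrightarrow> \<exists>n\<in>carrier N1. x = j1 n"
    "n \<in> carrier N1 \<Longrightarrow> p1 (j1 n) = \<zero>\<^bsub>M1\<^esub>"
proof -
  have "j1 ` carrier N1 = {x \<in> carrier E1. p1 x = \<zero>\<^bsub>M1\<^esub>}"
    using row1 by (simp add: short_exact_def a_kernel_def')
  then show "\<lbrakk>x \<in> carrier E1; p1 x = \<zero>\<^bsub>M1\<^esub>\<rbrakk> \<Longrightarrow> \<exists>n\<in>carrier N1. x = j1 n"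
    "n \<in> carrier N1 \<Longrightarrow> p1 (j1 n) = \<zero>\<^bsub>M1\<^esub>" by blast+
qed

lemma exact2: "\<lbrakk>x \<in> carrier E2; p2 x = \<zero>\<^bsub>M2\<^esub>\<rbrakk> \<Longrightarrow> \<exists>n\<in>carrier N2. x = j2 n"
    "n \<in> carrier N2 \<Longrightarrow> p2 (j2 n) = \<zero>\<^bsub>M2\<^esub>"
proof -
  have "j2 ` carrier N2 = {x \<in> carrier E2. p2 x = \<zero>\<^bsub>M2\<^esub>}"
    using row2 by (simp add: short_exact_def a_kernel_def')
  then show "\<lbrakk>x \<in> carrier E2; p2 x = \<zero>\<^bsub>M2\<^esub>\<rbrakk> \<Longrightarrow> \<exists>n\<in>carrier N2. x = j2 n"
    "n \<in> carrier N2 \<Longrightarrow> p2 (j2 n) = \<zero>\<^bsub>M2\<^esub>" by blast+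
qed

text \<open>Taking kernels is left exact, so surjectivity on the right is all that can fail. Exactness at
  the left holds because \<open>j2\<close> is injective.\<close>

lemma short_exact_kernels:
  assumes fg: "fg_module R (ker_module N1 N2 g)" "fg_module R (ker_module E1 E2 h)"
      "fg_module R (ker_module M1 M2 f)"
    and onto: "carrier (ker_module M1 M2 f) \<subseteq> p1 ` carrier (ker_module E1 E2 h)"
  shows "short_exact R (ker_module N1 N2 g) j1 (ker_module E1 E2 h) p1 (ker_module M1 M2 f)"
proof -
  have "inj_on j1 (carrier N1)" and inj2: "inj_on j2 (carrier N2)"
    using row1 row2 by (auto simp: short_exact_def)
  have z [simp]: "j2 \<zero>\<^bsub>N2\<^esub> = \<zero>\<^bsub>E2\<^esub>" "p2 \<zero>\<^bsub>E2\<^esub> = \<zero>\<^bsub>M2\<^esub>"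
    by (rule lmod_hom_zero[where R=R]; fact left_modules row_homs)+
  have j1_ker: "h (j1 x) = \<zero>\<^bsub>E2\<^esub> \<longleftrightarrow> g x = \<zero>\<^bsub>N2\<^esub>" if "x \<in> carrier N1" for x
    using that inj_onD[OF inj2, of "g x" "\<zero>\<^bsub>N2\<^esub>"] by (auto simp: comm_j)
  have "j1 \<in> lmod_hom R (ker_module N1 N2 g) (ker_module E1 E2 h)"
    by (rule lmod_homI) (auto simp: ker_module_def a_kernel_def' j1_ker lmod_homD(2,3)[OF row_homs(1)])
  moreover have "p1 \<in> lmod_hom R (ker_module E1 E2 h) (ker_module M1 M2 f)"
    by (rule lmod_homI) (auto simp: ker_module_def a_kernel_def' comm_p lmod_homD(2,3)[OF row_homs(2)])
  moreover have "inj_on j1 (carrier (ker_module N1 N2 g))"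
    using \<open>inj_on j1 (carrier N1)\<close> by (rule inj_on_subset) (auto simp: ker_module_def a_kernel_def')
  moreover have "j1 ` carrier (ker_module N1 N2 g) =
      a_kernel (ker_module E1 E2 h) (ker_module M1 M2 f) p1"
  proof (intro equalityI subsetI)
    fix y assume "y \<in> j1 ` carrier (ker_module N1 N2 g)"
    then show "y \<in> a_kernel (ker_module E1 E2 h) (ker_module M1 M2 f) p1"
      by (auto simp: ker_module_def a_kernel_def' j1_ker exact1(2))
  next
    fix y assume "y \<in> a_kernel (ker_module E1 E2 h) (ker_module M1 M2 f) p1"
    then have y: "y \<in> carrier E1" "h y = \<zero>\<^bsub>E2\<^esub>" "p1 y = \<zero>\<^bsub>M1\<^esub>"
      by (auto simp: ker_module_def a_kernel_def')
    then obtain n where "n \<in> carrier N1" "y = j1 n" using exact1(1) by blast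
    then show "y \<in> j1 ` carrier (ker_module N1 N2 g)"
      using y(2) by (simp add: ker_module_def a_kernel_def' j1_ker)
  qed
  moreover have "p1 ` carrier (ker_module E1 E2 h) = carrier (ker_module M1 M2 f)"
    using onto by (auto simp: ker_module_def a_kernel_def' comm_p)
  ultimately show ?thesis using fg unfolding short_exact_def by blast
qed

lemma images:
  "submodule (g ` carrier N1) R N2" "submodule (h ` carrier E1) R E2" "submodule (f ` carrier M1) R M2"
  using submodule_image left_modules g h f by blast+

lemma coker_map_j2:
  assumes "x \<in> carrier N2"
  shows "coker_map E1 E2 h j2 (g ` carrier N1 +>\<^bsub>N2\<^esub> x) = h ` carrier E1 +>\<^bsub>E2\<^esub> j2 x"
proof -
  have "j2 ` g ` carrier N1 \<subseteq> h ` carrier E1" by (auto simp flip: comm_j)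
  from coker_map_coset[OF left_modules(4,5,2) images(1) h row_homs(3) this assms] show ?thesis .
qed

lemma coker_map_p2:
  assumes "x \<in> carrier E2"
  shows "coker_map M1 M2 f p2 (h ` carrier E1 +>\<^bsub>E2\<^esub> x) = f ` carrier M1 +>\<^bsub>M2\<^esub> p2 x"
proof -
  have "p2 ` h ` carrier E1 \<subseteq> f ` carrier M1" by (auto simp flip: comm_p)
  from coker_map_coset[OF left_modules(5,6,3) images(2) f row_homs(4) this assms] show ?thesis .
qed

text \<open>Taking cokernels is right exact, so injectivity on the left is all that can fail. For exactness
  in the middle, let \<open>p2 x = f m\<close>. Lifting \<open>m\<close> to \<open>e\<close> along \<open>p1\<close> gives \<open>p2 (x - h e) = 0\<close>, so \<open>x\<close>
  agrees modulo the image of \<open>h\<close> with an element of the image of \<open>j2\<close>.\<close>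

lemma short_exact_cokernels:
  assumes inj: "inj_on (coker_map E1 E2 h j2) (carrier (coker_module N1 N2 g))"
  shows "short_exact R (coker_module N1 N2 g) (coker_map E1 E2 h j2) (coker_module E1 E2 h)
    (coker_map M1 M2 f p2) (coker_module M1 M2 f)"
proof -
  let ?G = "g ` carrier N1" and ?H = "h ` carrier E1" and ?F = "f ` carrier M1"
  let ?j = "coker_map E1 E2 h j2" and ?p = "coker_map M1 M2 f p2"
  note G = images(1) and H = images(2) and F = images(3)
  note j = coker_map_j2 and p = coker_map_p2
  note N3 = quotient_module_simps[OF left_modules(4) G]
  note E3 = quotient_module_simps[OF left_modules(5) H]
  note M3 = quotient_module_simps[OF left_modules(6) F]
  have surj2: "p2 ` carrier E2 = carrier M2" and surj1: "p1 ` carrier E1 = carrier M1"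
    using row1 row2 by (auto simp: short_exact_def)
  have "?j \<in> lmod_hom R (coker_module N1 N2 g) (coker_module E1 E2 h)"
    unfolding coker_module_def
    by (rule lmod_homI) (auto simp: N3 E3 j lmod_homD(2,3)[OF row_homs(3)] N2.smult_closed)
  moreover have "?p \<in> lmod_hom R (coker_module E1 E2 h) (coker_module M1 M2 f)"
    unfolding coker_module_def
    by (rule lmod_homI) (auto simp: E3 M3 p lmod_homD(2,3)[OF row_homs(4)] E2.smult_closed)
  moreover have "?p ` carrier (coker_module E1 E2 h) = carrier (coker_module M1 M2 f)"
  proof -
    have "?p ` carrier (coker_module E1 E2 h) = (\<lambda>x. ?F +>\<^bsub>M2\<^esub> p2 x) ` carrier E2"
      unfolding coker_module_def E3 image_image using p by (intro image_cong) auto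
    also have "\<dots> = (\<lambda>y. ?F +>\<^bsub>M2\<^esub> y) ` p2 ` carrier E2" by (simp add: image_image)
    finally show ?thesis by (simp add: surj2 coker_module_def M3)
  qed
  moreover have "?j ` carrier (coker_module N1 N2 g) =
      a_kernel (coker_module E1 E2 h) (coker_module M1 M2 f) ?p"
  proof -
    have ker: "?F +>\<^bsub>M2\<^esub> p2 x = ?F +>\<^bsub>M2\<^esub> \<zero>\<^bsub>M2\<^esub> \<longleftrightarrow> (\<exists>n\<in>carrier N2. ?H +>\<^bsub>E2\<^esub> x = ?H +>\<^bsub>E2\<^esub> j2 n)"
      if x: "x \<in> carrier E2" for x
    proof
      assume "?F +>\<^bsub>M2\<^esub> p2 x = ?F +>\<^bsub>M2\<^esub> \<zero>\<^bsub>M2\<^esub>"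
      then have "p2 x \<ominus>\<^bsub>M2\<^esub> \<zero>\<^bsub>M2\<^esub> \<in> ?F" using x by (subst (asm) M2.coset_eq_iff[OF F]) auto
      then obtain m where m: "m \<in> carrier M1" "p2 x = f m" using x
        by (auto simp: a_minus_def M2.M.minus_equality[of "\<zero>\<^bsub>M2\<^esub>" "\<zero>\<^bsub>M2\<^esub>"])
      then obtain e where e: "e \<in> carrier E1" "m = p1 e" using surj1 by auto
      then have "p2 (x \<ominus>\<^bsub>E2\<^esub> h e) = \<zero>\<^bsub>M2\<^esub>"
        using x m lmod_hom_minus[OF left_modules(5,6) row_homs(4), of x "h e"]
        by (simp add: comm_p a_minus_def M2.M.r_neg)
      then obtain n where n: "n \<in> carrier N2" "x \<ominus>\<^bsub>E2\<^esub> h e = j2 n"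
        using exact2(1)[of "x \<ominus>\<^bsub>E2\<^esub> h e"] x e by auto
      have "x \<ominus>\<^bsub>E2\<^esub> j2 n = h e"
        unfolding n(2)[symmetric] using x e
        by (simp add: a_minus_def E2.M.minus_add E2.M.r_neg2)
      then have "x \<ominus>\<^bsub>E2\<^esub> j2 n \<in> ?H" using e by blast
      then show "\<exists>n\<in>carrier N2. ?H +>\<^bsub>E2\<^esub> x = ?H +>\<^bsub>E2\<^esub> j2 n"
        using n(1) x E2.coset_eq_iff[OF H] by auto
    next
      assume "\<exists>n\<in>carrier N2. ?H +>\<^bsub>E2\<^esub> x = ?H +>\<^bsub>E2\<^esub> j2 n"
      then obtain n where n: "n \<in> carrier N2" "?H +>\<^bsub>E2\<^esub> x = ?H +>\<^bsub>E2\<^esub> j2 n" by blast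
      have "?F +>\<^bsub>M2\<^esub> p2 x = ?p (?H +>\<^bsub>E2\<^esub> j2 n)" using x n(2) p by metis
      then show "?F +>\<^bsub>M2\<^esub> p2 x = ?F +>\<^bsub>M2\<^esub> \<zero>\<^bsub>M2\<^esub>"
        using n(1) by (simp add: p exact2(2))
    qed
    have "a_kernel (coker_module E1 E2 h) (coker_module M1 M2 f) ?p =
        {?H +>\<^bsub>E2\<^esub> x | x. x \<in> carrier E2 \<and> ?F +>\<^bsub>M2\<^esub> p2 x = ?F +>\<^bsub>M2\<^esub> \<zero>\<^bsub>M2\<^esub>}"
      unfolding a_kernel_def' coker_module_def E3 M3 using p by auto
    also have "\<dots> = {?H +>\<^bsub>E2\<^esub> j2 n | n. n \<in> carrier N2}"
    proof (intro equalityI subsetI)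
      fix C assume "C \<in> {?H +>\<^bsub>E2\<^esub> x | x.
        x \<in> carrier E2 \<and> ?F +>\<^bsub>M2\<^esub> p2 x = ?F +>\<^bsub>M2\<^esub> \<zero>\<^bsub>M2\<^esub>}"
      then obtain x where "C = ?H +>\<^bsub>E2\<^esub> x" "x \<in> carrier E2"
        "?F +>\<^bsub>M2\<^esub> p2 x = ?F +>\<^bsub>M2\<^esub> \<zero>\<^bsub>M2\<^esub>" by blast
      then obtain n where "n \<in> carrier N2" "C = ?H +>\<^bsub>E2\<^esub> j2 n" using ker[of x] by auto
      then show "C \<in> {?H +>\<^bsub>E2\<^esub> j2 n | n. n \<in> carrier N2}" by blast
    next
      fix C assume "C \<in> {?H +>\<^bsub>E2\<^esub> j2 n | n. n \<in> carrier N2}"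
      then obtain n where n: "C = ?H +>\<^bsub>E2\<^esub> j2 n" "n \<in> carrier N2" by blast
      then have "?F +>\<^bsub>M2\<^esub> p2 (j2 n) = ?F +>\<^bsub>M2\<^esub> \<zero>\<^bsub>M2\<^esub>" using ker[of "j2 n"] by auto
      then show "C \<in> {?H +>\<^bsub>E2\<^esub> x | x.
        x \<in> carrier E2 \<and> ?F +>\<^bsub>M2\<^esub> p2 x = ?F +>\<^bsub>M2\<^esub> \<zero>\<^bsub>M2\<^esub>}"
        using n by (intro CollectI exI[of _ "j2 n"]) simp
    qed
    also have "\<dots> = ?j ` carrier (coker_module N1 N2 g)"
      unfolding coker_module_def N3 image_image using j by auto
    finally show ?thesis ..
  qed
  moreover have "fg_module R (coker_module N1 N2 g)" "fg_module R (coker_module E1 E2 h)"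
    "fg_module R (coker_module M1 M2 f)"
    unfolding coker_module_def
    using fg_quotient_module fg_modules G H F by blast+
  ultimately show ?thesis using inj unfolding short_exact_def by blast
qed

end

section \<open>Lifting along almost split maps\<close>

text \<open>The copy of a module on another type whose elements are renamed by \<open>F\<close>, which is meant to be
  injective on the carrier.\<close>

definition relabel :: "('a \<Rightarrow> 'b) \<Rightarrow> ('r, 'a) module \<Rightarrow> ('r, 'b) module" where
  "relabel F M =
     \<lparr>carrier = F ` carrier M, monoid.mult = undefined, monoid.one = undefined, zero = F \<zero>\<^bsub>M\<^esub>,
      add = (\<lambda>A B. F (inv_into (carrier M) F A \<oplus>\<^bsub>M\<^esub> inv_into (carrier M) F B)),
      smult = (\<lambda>r A. F (r \<odot>\<^bsub>M\<^esub> inv_into (carrier M) F A))\<rparr>"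

lemma relabel_isomorphism:
  assumes "fg_module R M" "inj_on F (carrier M)"
  shows "fg_module R (relabel F M)" "F \<in> lmod_hom R M (relabel F M)"
    "inv_into (carrier M) F \<in> lmod_hom R (relabel F M) M"
proof -
  interpret left_module R M using assms(1) by (rule fg_module_imp_left_module)
  have inv: "inv_into (carrier M) F (F x) = x" if "x \<in> carrier M" for x
    using assms(2) that by (rule inv_into_f_f)
  show "fg_module R (relabel F M)"
    by (rule fg_module_image[OF assms(1), of _ F]) (simp_all add: relabel_def inv)
  show "F \<in> lmod_hom R M (relabel F M)"
    by (rule lmod_homI) (simp_all add: relabel_def inv)
  show "inv_into (carrier M) F \<in> lmod_hom R (relabel F M) M"
    by (rule lmod_homI) (auto simp: relabel_def inv smult_closed)
qed

text \<open>Relative to finitely many generators, indexed by natural numbers, an element \<open>x\<close> of the module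
  is determined by the set of all coefficient families that represent \<open>x\<close>. This set lives in a type
  that depends on the ring only, and renaming every element to its set of representations gives an
  isomorphic module on that type.\<close>

lemma fg_module_small_copy:
  fixes M :: "('r, 'a) module"
  assumes "fg_module R M"
  obtains X :: "('r, (nat \<Rightarrow> 'r) set) module" and F G
  where "fg_module R X" "F \<in> lmod_hom R M X" "G \<in> lmod_hom R X M"
    "\<And>x. x \<in> carrier M \<Longrightarrow> G (F x) = x" "\<And>y. y \<in> carrier X \<Longrightarrow> F (G y) = y"
proof -
  interpret fg_module R M by fact
  obtain S where S: "finite S" "S \<subseteq> carrier M"
    "\<And>x. x \<in> carrier M \<Longrightarrow> \<exists>a \<in> S \<rightarrow> carrier R. x = (\<Oplus>\<^bsub>M\<^esub>s \<in> S. a s \<odot>\<^bsub>M\<^esub> s)"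
    using finitely_generated by blast
  obtain k :: "'a \<Rightarrow> nat" where k: "inj_on k S"
    using finite_imp_inj_to_nat_seg[OF S(1)] by blast
  define F :: "'a \<Rightarrow> (nat \<Rightarrow> 'r) set" where "F x = {a. (\<Oplus>\<^bsub>M\<^esub>s \<in> S. a (k s) \<odot>\<^bsub>M\<^esub> s) = x}" for x
  have ex: "\<exists>a. a \<in> F x" if x: "x \<in> carrier M" for x
  proof -
    obtain a where a: "a \<in> S \<rightarrow> carrier R" "x = (\<Oplus>\<^bsub>M\<^esub>s \<in> S. a s \<odot>\<^bsub>M\<^esub> s)"
      using S(3)[OF x] by blast
    have "(\<Oplus>\<^bsub>M\<^esub>s \<in> S. a (inv_into S k (k s)) \<odot>\<^bsub>M\<^esub> s) = (\<Oplus>\<^bsub>M\<^esub>s \<in> S. a s \<odot>\<^bsub>M\<^esub> s)"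
    proof (rule M.finsum_cong')
      show "(\<lambda>s. a s \<odot>\<^bsub>M\<^esub> s) \<in> S \<rightarrow> carrier M"
        using a(1) S(2) by (auto simp: Pi_iff subset_iff smult_closed)
    qed (simp_all add: k)
    then have "(\<lambda>i. a (inv_into S k i)) \<in> F x" using a(2) by (simp add: F_def)
    then show ?thesis by blast
  qed
  have inj: "inj_on F (carrier M)"
  proof (rule inj_onI)
    fix x y assume "x \<in> carrier M" "F x = F y"
    moreover from this obtain a where "a \<in> F x" using ex by blast
    ultimately have "a \<in> F x" "a \<in> F y" by auto
    then show "x = y" by (simp add: F_def)
  qed
  show thesis
  proof (rule that[OF relabel_isomorphism[OF assms inj]])
    show "inv_into (carrier M) F (F x) = x" if "x \<in> carrier M" for x
      using inj that by (rule inv_into_f_f)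
    show "F (inv_into (carrier M) F y) = y" if "y \<in> carrier (relabel F M)" for y
      using that by (simp add: relabel_def f_inv_into_f)
  qed
qed

text \<open>An almost split map has its lifting property against modules on every type, because any
  finitely generated module can be replaced by the isomorphic copy just constructed.\<close>

lemma right_almost_split_lift:
  assumes ras: "right_almost_split R B p C" and X: "fg_module R X"
    and u: "u \<in> lmod_hom R X C" "\<not> splittable_epi R X C u"
  shows "\<exists>v \<in> lmod_hom R X B. \<forall>x \<in> carrier X. p (v x) = u x"
proof -
  obtain X' :: "('a, (nat \<Rightarrow> 'a) set) module" and F G
    where X': "fg_module R X'" and F: "F \<in> lmod_hom R X X'" and G: "G \<in> lmod_hom R X' X"
      and GF: "\<And>x. x \<in> carrier X \<Longrightarrow> G (F x) = x"
    using fg_module_small_copy[OF X] by metis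
  have uG: "(\<lambda>y. u (G y)) \<in> lmod_hom R X' C" using G u(1) by (rule lmod_hom_comp)
  have "\<not> splittable_epi R X' C (\<lambda>y. u (G y))"
  proof
    assume "splittable_epi R X' C (\<lambda>y. u (G y))"
    then obtain s where s: "s \<in> lmod_hom R C X'" "\<forall>y \<in> carrier C. u (G (s y)) = y"
      by (auto simp: splittable_epi_def)
    have "(\<lambda>y. G (s y)) \<in> lmod_hom R C X" using s(1) G by (rule lmod_hom_comp)
    then have "splittable_epi R X C u"
      using u(1) s(2) unfolding splittable_epi_def by (intro conjI bexI[of _ "\<lambda>y. G (s y)"])
    then show False using u(2) by blast
  qed
  then obtain v where v: "v \<in> lmod_hom R X' B" "\<forall>y \<in> carrier X'. p (v y) = u (G y)"
    using ras X' uG unfolding right_almost_split_def by blast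
  have "(\<lambda>x. v (F x)) \<in> lmod_hom R X B" using F v(1) by (rule lmod_hom_comp)
  moreover have "\<forall>x \<in> carrier X. p (v (F x)) = u x"
    using v(2) lmod_hom_closed[OF F] by (simp add: GF)
  ultimately show ?thesis by (intro bexI[of _ "\<lambda>x. v (F x)"])
qed

lemma left_almost_split_lift:
  assumes las: "left_almost_split R A j B" and X: "fg_module R X"
    and u: "u \<in> lmod_hom R A X" "\<not> splittable_mono R A X u"
  shows "\<exists>v \<in> lmod_hom R B X. \<forall>x \<in> carrier A. v (j x) = u x"
proof -
  obtain X' :: "('a, (nat \<Rightarrow> 'a) set) module" and F G
    where X': "fg_module R X'" and F: "F \<in> lmod_hom R X X'" and G: "G \<in> lmod_hom R X' X"
      and GF: "\<And>x. x \<in> carrier X \<Longrightarrow> G (F x) = x"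
    using fg_module_small_copy[OF X] by metis
  have Fu: "(\<lambda>x. F (u x)) \<in> lmod_hom R A X'" using u(1) F by (rule lmod_hom_comp)
  have "\<not> splittable_mono R A X' (\<lambda>x. F (u x))"
  proof
    assume "splittable_mono R A X' (\<lambda>x. F (u x))"
    then obtain t where t: "t \<in> lmod_hom R X' A" "\<forall>x \<in> carrier A. t (F (u x)) = x"
      by (auto simp: splittable_mono_def)
    have "(\<lambda>y. t (F y)) \<in> lmod_hom R X A" using F t(1) by (rule lmod_hom_comp)
    then have "splittable_mono R A X u"
      using u(1) t(2) unfolding splittable_mono_def by (intro conjI bexI[of _ "\<lambda>y. t (F y)"])
    then show False using u(2) by blast
  qed
  then obtain v where v: "v \<in> lmod_hom R B X'" "\<forall>x \<in> carrier A. v (j x) = F (u x)"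
    using las X' Fu unfolding left_almost_split_def by blast
  have "(\<lambda>y. G (v y)) \<in> lmod_hom R B X" using v(1) G by (rule lmod_hom_comp)
  moreover have "\<forall>x \<in> carrier A. G (v (j x)) = u x"
    using v(2) lmod_hom_closed[OF u(1)] by (simp add: GF)
  ultimately show ?thesis by (intro bexI[of _ "\<lambda>y. G (v y)"])
qed


section \<open>The category of maps\<close>

lemma maps_objD:
  assumes "maps_obj L M1 M2 f"
  shows "fg_module L M1" "fg_module L M2" "left_module L M1" "left_module L M2"
    "f \<in> lmod_hom L M1 M2"
  using assms fg_module_imp_left_module by (auto simp: maps_obj_def)

lemma maps_homD:
  assumes "(a1, a2) \<in> maps_hom L M1 M2 f N1 N2 g"
  shows "a1 \<in> lmod_hom L M1 N1" "a2 \<in> lmod_hom L M2 N2"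
    "x \<in> carrier M1 \<Longrightarrow> g (a1 x) = a2 (f x)"
  using assms by (auto simp: maps_hom_def)

text \<open>Generators of \<open>M1\<close>, paired with \<open>0\<close>, and generators of \<open>M2\<close>, paired with \<open>0\<close>, generate
  \<open>tri_module M1 M2 f\<close>: the elements \<open>x\<close> for which \<open>(x, 0)\<close> lies in a given submodule form a
  submodule of \<open>M1\<close>, and likewise for \<open>M2\<close>.\<close>

lemma fg_module_tri_module:
  assumes "maps_obj L M1 M2 f"
  shows "fg_module (tri_ring L) (tri_module M1 M2 f)"
proof -
  note M = maps_objD[OF assms]
  interpret M1: left_module L M1 by (fact M)
  interpret M2: left_module L M2 by (fact M)
  note f = lmod_hom_closed[OF M(5)]
  obtain S where S: "finite S" "S \<subseteq> carrier M1"
    "\<And>N. \<lbrakk>submodule N L M1; S \<subseteq> N\<rbrakk> \<Longrightarrow> carrier M1 \<subseteq> N" using fg_moduleE[OF M(1)] by blast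
  obtain T where T: "finite T" "T \<subseteq> carrier M2"
    "\<And>N. \<lbrakk>submodule N L M2; T \<subseteq> N\<rbrakk> \<Longrightarrow> carrier M2 \<subseteq> N" using fg_moduleE[OF M(2)] by blast
  show ?thesis
  proof (rule fg_moduleI[OF left_module_tri_module[OF M(3-5)]])
    let ?U = "S \<times> {\<zero>\<^bsub>M2\<^esub>} \<union> {\<zero>\<^bsub>M1\<^esub>} \<times> T"
    show "finite ?U" using S(1) T(1) by simp
    show "?U \<subseteq> carrier (tri_module M1 M2 f)" using S(2) T(2) by (auto simp: tri_module_def)
    fix N assume N: "submodule N (tri_ring L) (tri_module M1 M2 f)" and sub: "?U \<subseteq> N"
    have add: "(x \<oplus>\<^bsub>M1\<^esub> x', y \<oplus>\<^bsub>M2\<^esub> y') \<in> N" if "(x, y) \<in> N" "(x', y') \<in> N" for x y x' y'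
      using submodule_add[OF N that] by (simp add: tri_module_def)
    have smult: "(a \<odot>\<^bsub>M1\<^esub> x, b \<odot>\<^bsub>M2\<^esub> f x \<oplus>\<^bsub>M2\<^esub> c \<odot>\<^bsub>M2\<^esub> y) \<in> N"
      if "(x, y) \<in> N" "a \<in> carrier L" "b \<in> carrier L" "c \<in> carrier L" for x y a b c
      using submodule_smult[OF N, of "(a, b, c)" "(x, y)"] that
      by (simp add: tri_module_def tri_ring_def)
    have zero: "(\<zero>\<^bsub>M1\<^esub>, \<zero>\<^bsub>M2\<^esub>) \<in> N"
      using submodule_zero[OF N] by (simp add: tri_module_def)
    have "submodule {x \<in> carrier M1. (x, \<zero>\<^bsub>M2\<^esub>) \<in> N} L M1"
    proof (rule M1.submoduleI)
      show "x \<oplus>\<^bsub>M1\<^esub> y \<in> {x \<in> carrier M1. (x, \<zero>\<^bsub>M2\<^esub>) \<in> N}"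
        if "x \<in> {x \<in> carrier M1. (x, \<zero>\<^bsub>M2\<^esub>) \<in> N}" "y \<in> {x \<in> carrier M1. (x, \<zero>\<^bsub>M2\<^esub>) \<in> N}" for x y
        using add[of x "\<zero>\<^bsub>M2\<^esub>" y "\<zero>\<^bsub>M2\<^esub>"] that by simp
      show "r \<odot>\<^bsub>M1\<^esub> x \<in> {x \<in> carrier M1. (x, \<zero>\<^bsub>M2\<^esub>) \<in> N}"
        if "r \<in> carrier L" "x \<in> {x \<in> carrier M1. (x, \<zero>\<^bsub>M2\<^esub>) \<in> N}" for r x
        using smult[of x "\<zero>\<^bsub>M2\<^esub>" r "\<zero>\<^bsub>L\<^esub>" "\<zero>\<^bsub>L\<^esub>"] that by (simp add: f M1.smult_closed)
    qed (auto simp: zero)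
    then have left: "carrier M1 \<subseteq> {x \<in> carrier M1. (x, \<zero>\<^bsub>M2\<^esub>) \<in> N}"
      using sub S(2) by (intro S(3)) auto
    have zM1: "f \<zero>\<^bsub>M1\<^esub> = \<zero>\<^bsub>M2\<^esub>" using M(3-5) by (rule lmod_hom_zero)
    have "submodule {y \<in> carrier M2. (\<zero>\<^bsub>M1\<^esub>, y) \<in> N} L M2"
    proof (rule M2.submoduleI)
      show "x \<oplus>\<^bsub>M2\<^esub> y \<in> {y \<in> carrier M2. (\<zero>\<^bsub>M1\<^esub>, y) \<in> N}"
        if "x \<in> {y \<in> carrier M2. (\<zero>\<^bsub>M1\<^esub>, y) \<in> N}" "y \<in> {y \<in> carrier M2. (\<zero>\<^bsub>M1\<^esub>, y) \<in> N}" for x y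
        using add[of "\<zero>\<^bsub>M1\<^esub>" x "\<zero>\<^bsub>M1\<^esub>" y] that by simp
      show "r \<odot>\<^bsub>M2\<^esub> x \<in> {y \<in> carrier M2. (\<zero>\<^bsub>M1\<^esub>, y) \<in> N}"
        if "r \<in> carrier L" "x \<in> {y \<in> carrier M2. (\<zero>\<^bsub>M1\<^esub>, y) \<in> N}" for r x
        using smult[of "\<zero>\<^bsub>M1\<^esub>" x "\<zero>\<^bsub>L\<^esub>" "\<zero>\<^bsub>L\<^esub>" r] that by (simp add: zM1 M2.smult_closed)
    qed (auto simp: zero)
    then have right: "carrier M2 \<subseteq> {y \<in> carrier M2. (\<zero>\<^bsub>M1\<^esub>, y) \<in> N}"
      using sub T(2) by (intro T(3)) auto
    show "carrier (tri_module M1 M2 f) \<subseteq> N"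
    proof
      fix z assume "z \<in> carrier (tri_module M1 M2 f)"
      then obtain x y where z: "z = (x, y)" "x \<in> carrier M1" "y \<in> carrier M2"
        by (auto simp: tri_module_def)
      then have "(x, \<zero>\<^bsub>M2\<^esub>) \<in> N" "(\<zero>\<^bsub>M1\<^esub>, y) \<in> N" using left right by auto
      from add[OF this] show "z \<in> N" using z by simp
    qed
  qed
qed

text \<open>The matrix units \<open>(1, 0, 0)\<close> and \<open>(0, 0, 1)\<close> act as the projections to the two summands, so a
  homomorphism over the triangular matrix ring preserves them.\<close>

lemma tri_module_hom_componentsE:
  assumes M: "left_module L M1" "left_module L M2" "f \<in> lmod_hom L M1 M2"
    and N: "left_module L N1" "left_module L N2" "g \<in> lmod_hom L N1 N2"
    and v: "v \<in> lmod_hom (tri_ring L) (tri_module M1 M2 f) (tri_module N1 N2 g)"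
  obtains v1 v2 where "(v1, v2) \<in> maps_hom L M1 M2 f N1 N2 g"
    "\<And>x y. \<lbrakk>x \<in> carrier M1; y \<in> carrier M2\<rbrakk> \<Longrightarrow> v (x, y) = (v1 x, v2 y)"
proof -
  interpret M1: left_module L M1 by fact
  interpret M2: left_module L M2 by fact
  interpret N1: left_module L N1 by fact
  interpret N2: left_module L N2 by fact
  note f = lmod_hom_closed[OF M(3)] and g = lmod_hom_closed[OF N(3)]
  have vc: "fst (v (x, y)) \<in> carrier N1" "snd (v (x, y)) \<in> carrier N2"
    if "x \<in> carrier M1" "y \<in> carrier M2" for x y
    using lmod_hom_closed[OF v, of "(x, y)"] that by (auto simp: tri_module_def)
  define v1 where "v1 x = fst (v (x, \<zero>\<^bsub>M2\<^esub>))" for x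
  define v2 where "v2 y = snd (v (\<zero>\<^bsub>M1\<^esub>, y))" for y
  have act: "v (a \<odot>\<^bsub>M1\<^esub> x, b \<odot>\<^bsub>M2\<^esub> f x \<oplus>\<^bsub>M2\<^esub> c \<odot>\<^bsub>M2\<^esub> y) =
      (a \<odot>\<^bsub>N1\<^esub> fst (v (x, y)), b \<odot>\<^bsub>N2\<^esub> g (fst (v (x, y))) \<oplus>\<^bsub>N2\<^esub> c \<odot>\<^bsub>N2\<^esub> snd (v (x, y)))"
    if "x \<in> carrier M1" "y \<in> carrier M2" "a \<in> carrier L" "b \<in> carrier L" "c \<in> carrier L"
    for x y a b c
    using lmod_hom_smult[OF v, of "(a, b, c)" "(x, y)"] that
    by (simp add: tri_module_def tri_ring_def split_beta)
  have comp: "v (x, y) = (v1 x, v2 y)" if x: "x \<in> carrier M1" and y: "y \<in> carrier M2" for x y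
  proof -
    have "v (x, \<zero>\<^bsub>M2\<^esub>) = (fst (v (x, y)), \<zero>\<^bsub>N2\<^esub>)"
      using act[OF x y, of "\<one>\<^bsub>L\<^esub>" "\<zero>\<^bsub>L\<^esub>" "\<zero>\<^bsub>L\<^esub>"] x y vc[OF x y]
      by (simp add: f g M1.smult_one N1.smult_one)
    moreover have "v (\<zero>\<^bsub>M1\<^esub>, y) = (\<zero>\<^bsub>N1\<^esub>, snd (v (x, y)))"
      using act[OF x y, of "\<zero>\<^bsub>L\<^esub>" "\<zero>\<^bsub>L\<^esub>" "\<one>\<^bsub>L\<^esub>"] x y vc[OF x y]
      by (simp add: f g M2.smult_one N2.smult_one)
    ultimately show ?thesis by (simp add: v1_def v2_def)
  qed
  have "map_prod v1 v2 \<in> lmod_hom (tri_ring L) (tri_module M1 M2 f) (tri_module N1 N2 g)"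
  proof -
    have eq: "map_prod v1 v2 z = v z" if "z \<in> carrier (tri_module M1 M2 f)" for z
      using that comp by (auto simp: tri_module_def)
    interpret T: left_module "tri_ring L" "tri_module M1 M2 f"
      using M by (rule left_module_tri_module)
    show ?thesis
      by (rule lmod_homI) (simp_all add: eq lmod_homD[OF v] T.smult_closed)
  qed
  then have "(v1, v2) \<in> maps_hom L M1 M2 f N1 N2 g"
    by (subst (asm) map_prod_mem_lmod_hom_iff[OF M N])
  then show thesis using comp that by blast
qed

text \<open>Homomorphisms over the triangular matrix ring are pairs of homomorphisms over \<open>L\<close>, hence so are
  the sections that have to be excluded and the lifts that result. The lifting property can
  therefore be used entirely within the category of maps.\<close>

lemma maps_right_almost_split_lift:
  assumes "right_almost_split (tri_ring L) (tri_module E1 E2 h) (map_prod p1 p2) (tri_module M1 M2 f)"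
    and E: "maps_obj L E1 E2 h" and M: "maps_obj L M1 M2 f" and X: "maps_obj L X1 X2 k"
    and u: "(u1, u2) \<in> maps_hom L X1 X2 k M1 M2 f"
    and nonsplit: "\<And>s1 s2. \<lbrakk>(s1, s2) \<in> maps_hom L M1 M2 f X1 X2 k;
      \<And>y. y \<in> carrier M1 \<Longrightarrow> u1 (s1 y) = y; \<And>y. y \<in> carrier M2 \<Longrightarrow> u2 (s2 y) = y\<rbrakk> \<Longrightarrow> False"
  obtains v1 v2 where "(v1, v2) \<in> maps_hom L X1 X2 k E1 E2 h"
    "\<And>x. x \<in> carrier X1 \<Longrightarrow> p1 (v1 x) = u1 x" "\<And>x. x \<in> carrier X2 \<Longrightarrow> p2 (v2 x) = u2 x"
proof -
  note E' = maps_objD(3-5)[OF E] and M' = maps_objD(3-5)[OF M] and X' = maps_objD(3-5)[OF X]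
  interpret X1: left_module L X1 by (fact X')
  interpret X2: left_module L X2 by (fact X')
  interpret M1: left_module L M1 by (fact M')
  interpret M2: left_module L M2 by (fact M')
  have uh: "map_prod u1 u2 \<in> lmod_hom (tri_ring L) (tri_module X1 X2 k) (tri_module M1 M2 f)"
    using u by (subst map_prod_mem_lmod_hom_iff[OF X' M'])
  have "\<not> splittable_epi (tri_ring L) (tri_module X1 X2 k) (tri_module M1 M2 f) (map_prod u1 u2)"
  proof
    assume "splittable_epi (tri_ring L) (tri_module X1 X2 k) (tri_module M1 M2 f) (map_prod u1 u2)"
    then obtain s where s: "s \<in> lmod_hom (tri_ring L) (tri_module M1 M2 f) (tri_module X1 X2 k)"
      "\<forall>z \<in> carrier (tri_module M1 M2 f). map_prod u1 u2 (s z) = z"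
      by (auto simp: splittable_epi_def)
    obtain s1 s2 where s12: "(s1, s2) \<in> maps_hom L M1 M2 f X1 X2 k"
      "\<And>x y. \<lbrakk>x \<in> carrier M1; y \<in> carrier M2\<rbrakk> \<Longrightarrow> s (x, y) = (s1 x, s2 y)"
      by (rule tri_module_hom_componentsE[OF M' X' s(1)]) blast
    have "u1 (s1 x) = x \<and> u2 (s2 y) = y" if "x \<in> carrier M1" "y \<in> carrier M2" for x y
      using bspec[OF s(2), of "(x, y)"] that by (simp add: tri_module_def s12(2))
    then show False using nonsplit[OF s12(1)] M1.M.zero_closed M2.M.zero_closed by metis
  qed
  then obtain v where v: "v \<in> lmod_hom (tri_ring L) (tri_module X1 X2 k) (tri_module E1 E2 h)"
    "\<forall>z \<in> carrier (tri_module X1 X2 k). map_prod p1 p2 (v z) = map_prod u1 u2 z"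
    using right_almost_split_lift[OF assms(1) fg_module_tri_module[OF X] uh] by blast
  obtain v1 v2 where v12: "(v1, v2) \<in> maps_hom L X1 X2 k E1 E2 h"
    "\<And>x y. \<lbrakk>x \<in> carrier X1; y \<in> carrier X2\<rbrakk> \<Longrightarrow> v (x, y) = (v1 x, v2 y)"
    by (rule tri_module_hom_componentsE[OF X' E' v(1)]) blast
  have "p1 (v1 x) = u1 x \<and> p2 (v2 y) = u2 y" if "x \<in> carrier X1" "y \<in> carrier X2" for x y
    using bspec[OF v(2), of "(x, y)"] that by (simp add: tri_module_def v12(2))
  then show thesis using that[OF v12(1)] X1.M.zero_closed X2.M.zero_closed by metis
qed

lemma maps_left_almost_split_lift:
  assumes "left_almost_split (tri_ring L) (tri_module N1 N2 g) (map_prod j1 j2) (tri_module E1 E2 h)"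
    and N: "maps_obj L N1 N2 g" and E: "maps_obj L E1 E2 h" and X: "maps_obj L X1 X2 k"
    and j: "(j1, j2) \<in> maps_hom L N1 N2 g E1 E2 h"
    and u: "(u1, u2) \<in> maps_hom L N1 N2 g X1 X2 k"
    and nonsplit: "\<And>t1 t2. \<lbrakk>(t1, t2) \<in> maps_hom L X1 X2 k N1 N2 g;
      \<And>x. x \<in> carrier N1 \<Longrightarrow> t1 (u1 x) = x; \<And>x. x \<in> carrier N2 \<Longrightarrow> t2 (u2 x) = x\<rbrakk> \<Longrightarrow> False"
  obtains v1 v2 where "(v1, v2) \<in> maps_hom L E1 E2 h X1 X2 k"
    "\<And>x. x \<in> carrier N1 \<Longrightarrow> v1 (j1 x) = u1 x" "\<And>x. x \<in> carrier N2 \<Longrightarrow> v2 (j2 x) = u2 x"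
proof -
  note E' = maps_objD(3-5)[OF E] and N' = maps_objD(3-5)[OF N] and X' = maps_objD(3-5)[OF X]
  interpret N1: left_module L N1 by (fact N')
  interpret N2: left_module L N2 by (fact N')
  have j_closed: "j1 x \<in> carrier E1" "j2 y \<in> carrier E2"
    if "x \<in> carrier N1" "y \<in> carrier N2" for x y
    using j that by (auto simp: maps_hom_def lmod_hom_closed)
  have u_closed: "u1 x \<in> carrier X1" "u2 y \<in> carrier X2"
    if "x \<in> carrier N1" "y \<in> carrier N2" for x y
    using u that by (auto simp: maps_hom_def lmod_hom_closed)
  have uh: "map_prod u1 u2 \<in> lmod_hom (tri_ring L) (tri_module N1 N2 g) (tri_module X1 X2 k)"
    using u by (subst map_prod_mem_lmod_hom_iff[OF N' X'])
  have "\<not> splittable_mono (tri_ring L) (tri_module N1 N2 g) (tri_module X1 X2 k) (map_prod u1 u2)"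
  proof
    assume "splittable_mono (tri_ring L) (tri_module N1 N2 g) (tri_module X1 X2 k) (map_prod u1 u2)"
    then obtain t where t: "t \<in> lmod_hom (tri_ring L) (tri_module X1 X2 k) (tri_module N1 N2 g)"
      "\<forall>z \<in> carrier (tri_module N1 N2 g). t (map_prod u1 u2 z) = z"
      by (auto simp: splittable_mono_def)
    obtain t1 t2 where t12: "(t1, t2) \<in> maps_hom L X1 X2 k N1 N2 g"
      "\<And>x y. \<lbrakk>x \<in> carrier X1; y \<in> carrier X2\<rbrakk> \<Longrightarrow> t (x, y) = (t1 x, t2 y)"
      by (rule tri_module_hom_componentsE[OF X' N' t(1)]) blast
    have "t1 (u1 x) = x \<and> t2 (u2 y) = y" if "x \<in> carrier N1" "y \<in> carrier N2" for x y
      using bspec[OF t(2), of "(x, y)"] that u_closed[OF that] by (simp add: tri_module_def t12(2))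
    then show False using nonsplit[OF t12(1)] N1.M.zero_closed N2.M.zero_closed by metis
  qed
  then obtain v where v: "v \<in> lmod_hom (tri_ring L) (tri_module E1 E2 h) (tri_module X1 X2 k)"
    "\<forall>z \<in> carrier (tri_module N1 N2 g). v (map_prod j1 j2 z) = map_prod u1 u2 z"
    using left_almost_split_lift[OF assms(1) fg_module_tri_module[OF X] uh] by blast
  obtain v1 v2 where v12: "(v1, v2) \<in> maps_hom L E1 E2 h X1 X2 k"
    "\<And>x y. \<lbrakk>x \<in> carrier E1; y \<in> carrier E2\<rbrakk> \<Longrightarrow> v (x, y) = (v1 x, v2 y)"
    by (rule tri_module_hom_componentsE[OF E' X' v(1)]) blast
  have "v1 (j1 x) = u1 x \<and> v2 (j2 y) = u2 y" if "x \<in> carrier N1" "y \<in> carrier N2" for x y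
    using bspec[OF v(2), of "(x, y)"] that j_closed[OF that] by (simp add: tri_module_def v12(2))
  then show thesis using that[OF v12(1)] N1.M.zero_closed N2.M.zero_closed by metis
qed

text \<open>Image and kernel of a pair of maps are products of images and kernels, and a product of
  nonempty sets determines its factors.\<close>

lemma short_exact_components:
  assumes N: "maps_obj L N1 N2 g" and E: "maps_obj L E1 E2 h" and M: "maps_obj L M1 M2 f"
    and j: "(j1, j2) \<in> maps_hom L N1 N2 g E1 E2 h" and p: "(p1, p2) \<in> maps_hom L E1 E2 h M1 M2 f"
    and exact: "short_exact (tri_ring L) (tri_module N1 N2 g) (map_prod j1 j2) (tri_module E1 E2 h)
      (map_prod p1 p2) (tri_module M1 M2 f)"
  shows "short_exact_rows L N1 N2 g E1 E2 h M1 M2 f j1 j2 p1 p2"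
proof -
  interpret N1: left_module L N1 using maps_objD[OF N] by blast
  interpret N2: left_module L N2 using maps_objD[OF N] by blast
  interpret E1: left_module L E1 using maps_objD[OF E] by blast
  interpret E2: left_module L E2 using maps_objD[OF E] by blast
  note ne = N1.M.zero_closed N2.M.zero_closed E1.M.zero_closed E2.M.zero_closed
  have inj: "inj_on (map_prod j1 j2) (carrier N1 \<times> carrier N2)"
    using exact by (simp add: short_exact_def tri_module_def)
  have inj1: "inj_on j1 (carrier N1)"
    using inj_onD[OF inj, of "(x, \<zero>\<^bsub>N2\<^esub>)" "(y, \<zero>\<^bsub>N2\<^esub>)" for x y] by (intro inj_onI) auto
  have inj2: "inj_on j2 (carrier N2)"
    using inj_onD[OF inj, of "(\<zero>\<^bsub>N1\<^esub>, x)" "(\<zero>\<^bsub>N1\<^esub>, y)" for x y] by (intro inj_onI) auto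
  have "map_prod j1 j2 ` (carrier N1 \<times> carrier N2) =
      {z \<in> carrier E1 \<times> carrier E2. map_prod p1 p2 z = (\<zero>\<^bsub>M1\<^esub>, \<zero>\<^bsub>M2\<^esub>)}"
    using exact by (simp add: short_exact_def tri_module_def a_kernel_def')
  also have "\<dots> = a_kernel E1 M1 p1 \<times> a_kernel E2 M2 p2"
    by (auto simp: a_kernel_def')
  finally have "j1 ` carrier N1 \<times> j2 ` carrier N2 = a_kernel E1 M1 p1 \<times> a_kernel E2 M2 p2"
    by (simp add: map_prod_surj_on[OF refl refl])
  then have im: "j1 ` carrier N1 = a_kernel E1 M1 p1" "j2 ` carrier N2 = a_kernel E2 M2 p2"
    using ne by (auto simp: times_eq_iff)
  have "p1 ` carrier E1 \<times> p2 ` carrier E2 = carrier M1 \<times> carrier M2"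
    using exact unfolding map_prod_surj_on[OF refl refl, symmetric]
    by (simp add: short_exact_def tri_module_def)
  then have surj: "p1 ` carrier E1 = carrier M1" "p2 ` carrier E2 = carrier M2"
    using ne by (auto simp: times_eq_iff)
  show ?thesis
    using N E M j p inj1 inj2 im surj
    by unfold_locales (simp_all add: short_exact_def maps_obj_def maps_hom_def)
qed

definition zero_module :: "('r, unit) module" where
  "zero_module = \<lparr>carrier = {()}, monoid.mult = undefined, monoid.one = undefined, zero = (),
     add = \<lambda>_ _. (), smult = \<lambda>_ _. ()\<rparr>"

lemma fg_zero_module:
  assumes "fg_module R M"
  shows "fg_module R zero_module"
proof -
  interpret left_module R M using assms by (rule fg_module_imp_left_module)
  have "left_module R zero_module"
    by (intro left_module.intro left_module_axioms.intro abelian_groupI R.ring_axioms)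
      (simp_all add: zero_module_def)
  then show ?thesis
  proof (rule fg_moduleI)
    fix N assume "submodule N R zero_module"
    from submodule_zero[OF this] show "carrier zero_module \<subseteq> N"
      by (simp add: zero_module_def)
  qed (rule finite.emptyI empty_subsetI)+
qed

lemma hom_to_zero_module: "(\<lambda>_. ()) \<in> lmod_hom R M zero_module"
  by (rule lmod_homI) (simp_all add: zero_module_def)

lemma zero_hom:
  assumes "left_module R M"
  shows "(\<lambda>_. \<zero>\<^bsub>M\<^esub>) \<in> lmod_hom R A M"
proof -
  interpret left_module R M by fact
  show ?thesis by (rule lmod_homI) simp_all
qed

section \<open>The induced sequences of an almost split sequence of maps\<close>

theorem theorem3p3:
  fixes R :: "('k, 'x) ring_scheme" and \<phi> :: "'k \<Rightarrow> 'r" and \<Lambda> :: "('r, 'y) ring_scheme"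
    and N1 :: "('r, 'n1) module" and N2 :: "('r, 'n2) module" and g :: "'n1 \<Rightarrow> 'n2"
    and E1 :: "('r, 'e1) module" and E2 :: "('r, 'e2) module" and h :: "'e1 \<Rightarrow> 'e2"
    and M1 :: "('r, 'm1) module" and M2 :: "('r, 'm2) module" and f :: "'m1 \<Rightarrow> 'm2"
    and j1 :: "'n1 \<Rightarrow> 'e1" and j2 :: "'n2 \<Rightarrow> 'e2"
    and p1 :: "'e1 \<Rightarrow> 'm1" and p2 :: "'e2 \<Rightarrow> 'm2"
  assumes "artin_algebra R \<phi> \<Lambda>"
    and "maps_obj \<Lambda> N1 N2 g" and "maps_obj \<Lambda> E1 E2 h" and "maps_obj \<Lambda> M1 M2 f"
    and "(j1, j2) \<in> maps_hom \<Lambda> N1 N2 g E1 E2 h"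
    and "(p1, p2) \<in> maps_hom \<Lambda> E1 E2 h M1 M2 f"
    and "almost_split_sequence (tri_ring \<Lambda>)
           (tri_module N1 N2 g) (map_prod j1 j2)
           (tri_module E1 E2 h) (map_prod p1 p2)
           (tri_module M1 M2 f)"
    and "\<not> splittable_epi \<Lambda> N1 N2 g" and "\<not> splittable_mono \<Lambda> N1 N2 g"
    and "\<not> splittable_epi \<Lambda> M1 M2 f" and "\<not> splittable_mono \<Lambda> M1 M2 f"
  defines "N0 \<equiv> ker_module N1 N2 g" and "E0 \<equiv> ker_module E1 E2 h"
    and "M0 \<equiv> ker_module M1 M2 f"
    and "N3 \<equiv> coker_module N1 N2 g" and "E3 \<equiv> coker_module E1 E2 h"
    and "M3 \<equiv> coker_module M1 M2 f"
    and "j3 \<equiv> coker_map E1 E2 h j2" and "p3 \<equiv> coker_map M1 M2 f p2"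
  shows "p1 ` carrier E0 = carrier M0 \<and> inj_on j3 (carrier N3) \<and>
    split_short_exact \<Lambda> N0 j1 E0 p1 M0 \<and>
    split_short_exact \<Lambda> N1 j1 E1 p1 M1 \<and>
    split_short_exact \<Lambda> N2 j2 E2 p2 M2 \<and>
    split_short_exact \<Lambda> N3 j3 E3 p3 M3"
proof -
  interpret artin_algebra R \<phi> \<Lambda> by fact
  note N = assms(2) and E = assms(3) and M = assms(4) and j_hom = assms(5)
  have las: "left_almost_split (tri_ring \<Lambda>) (tri_module N1 N2 g) (map_prod j1 j2) (tri_module E1 E2 h)"
    and ras: "right_almost_split (tri_ring \<Lambda>) (tri_module E1 E2 h) (map_prod p1 p2) (tri_module M1 M2 f)"
    and exact: "short_exact (tri_ring \<Lambda>) (tri_module N1 N2 g) (map_prod j1 j2)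
      (tri_module E1 E2 h) (map_prod p1 p2) (tri_module M1 M2 f)"
    using assms(7) by (simp_all add: almost_split_sequence_def)
  interpret short_exact_rows \<Lambda> N1 N2 g E1 E2 h M1 M2 f j1 j2 p1 p2
    using N E M assms(5,6) exact by (rule short_exact_components)
  have zero_fg: "fg_module \<Lambda> zero_module" using fg_modules(1) by (rule fg_zero_module)
  have f0: "f \<zero>\<^bsub>M1\<^esub> = \<zero>\<^bsub>M2\<^esub>" using left_modules(3,6) f by (rule lmod_hom_zero)

  \<comment> \<open>A section \<open>(s1, s2)\<close> of \<open>(1, f) : (M1, M1, 1) \<rightarrow> (M1, M2, f)\<close> would have \<open>s1 = 1\<close>, and then
    \<open>s2\<close> would be a retraction of \<open>f\<close>. So \<open>(1, f)\<close> lifts, and the first component of the lift is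
    a section of \<open>p1\<close>.\<close>
  have epi1: "splittable_epi \<Lambda> E1 M1 p1"
  proof -
    have X: "maps_obj \<Lambda> M1 M1 (\<lambda>x. x)"
      by (simp add: maps_obj_def fg_modules lmod_hom_id)
    have u: "(\<lambda>x. x, f) \<in> maps_hom \<Lambda> M1 M1 (\<lambda>x. x) M1 M2 f"
      by (simp add: maps_hom_def lmod_hom_id f)
    obtain v1 v2 where "(v1, v2) \<in> maps_hom \<Lambda> M1 M1 (\<lambda>x. x) E1 E2 h"
      "\<And>x. x \<in> carrier M1 \<Longrightarrow> p1 (v1 x) = x"
    proof (rule maps_right_almost_split_lift[OF ras E M X u])
      fix s1 s2 assume s: "(s1, s2) \<in> maps_hom \<Lambda> M1 M2 f M1 M1 (\<lambda>x. x)"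
        "\<And>y. y \<in> carrier M1 \<Longrightarrow> s1 y = y"
      have "s2 (f x) = x" if "x \<in> carrier M1" for x
        using maps_homD(3)[OF s(1) that] s(2)[OF that] by simp
      with f maps_homD(2)[OF s(1)] have "splittable_mono \<Lambda> M1 M2 f" by (rule splittable_monoI)
      then show False using assms(11) by simp
    qed blast
    then show ?thesis by (intro splittable_epiI[OF row_homs(2)] maps_homD(1))
  qed

  \<comment> \<open>The morphism \<open>(0, 1) : (0, M2, 0) \<rightarrow> (M1, M2, f)\<close> splits only if \<open>M1\<close> is zero, in which case
    \<open>f\<close> is a splittable monomorphism.\<close>
  have epi2: "splittable_epi \<Lambda> E2 M2 p2"
  proof -
    have X: "maps_obj \<Lambda> zero_module M2 (\<lambda>_. \<zero>\<^bsub>M2\<^esub>)"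
      by (simp add: maps_obj_def zero_fg fg_modules(6) zero_hom[OF left_modules(6)])
    have u: "(\<lambda>_. \<zero>\<^bsub>M1\<^esub>, \<lambda>x. x) \<in> maps_hom \<Lambda> zero_module M2 (\<lambda>_. \<zero>\<^bsub>M2\<^esub>) M1 M2 f"
      by (simp add: maps_hom_def zero_hom[OF left_modules(3)] lmod_hom_id f0)
    obtain v1 v2 where "(v1, v2) \<in> maps_hom \<Lambda> zero_module M2 (\<lambda>_. \<zero>\<^bsub>M2\<^esub>) E1 E2 h"
      "\<And>x. x \<in> carrier M2 \<Longrightarrow> p2 (v2 x) = x"
    proof (rule maps_right_almost_split_lift[OF ras E M X u])
      assume "\<And>y. y \<in> carrier M1 \<Longrightarrow> \<zero>\<^bsub>M1\<^esub> = y"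
      with f zero_hom[OF left_modules(3)] have "splittable_mono \<Lambda> M1 M2 f"
        by (rule splittable_monoI)
      then show False using assms(11) by simp
    qed blast
    then show ?thesis by (intro splittable_epiI[OF row_homs(4)] maps_homD(2))
  qed

  have fg0: "fg_module \<Lambda> N0" "fg_module \<Lambda> E0" "fg_module \<Lambda> M0"
    unfolding N0_def E0_def M0_def ker_module_def
    by (intro fg_submodule submodule_kernel fg_modules left_modules g h f)+
  have M0_iff: "x \<in> carrier M0 \<longleftrightarrow> x \<in> carrier M1 \<and> f x = \<zero>\<^bsub>M2\<^esub>" for x
    by (simp add: M0_def ker_module_def a_kernel_def')
  have E0_iff: "x \<in> carrier E0 \<longleftrightarrow> x \<in> carrier E1 \<and> h x = \<zero>\<^bsub>E2\<^esub>" for x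
    by (simp add: E0_def ker_module_def a_kernel_def')
  \<comment> \<open>The inclusion \<open>(M0, 0, 0) \<rightarrow> (M1, M2, f)\<close> splits only if \<open>M2\<close> is zero, in which case \<open>f\<close> is a
    splittable epimorphism. The second component of a lift starts at the zero module, so the
    first one takes values in the kernel of \<open>h\<close>.\<close>
  have "\<exists>s \<in> lmod_hom \<Lambda> M0 E0. \<forall>x \<in> carrier M0. p1 (s x) = x"
  proof -
    have X: "maps_obj \<Lambda> M0 zero_module (\<lambda>_. ())"
      by (simp add: maps_obj_def zero_fg fg0(3) hom_to_zero_module)
    have incl: "(\<lambda>x. x) \<in> lmod_hom \<Lambda> M0 M1"
      by (rule lmod_homI) (simp_all add: M0_def ker_module_def a_kernel_def')
    have u: "(\<lambda>x. x, \<lambda>_. \<zero>\<^bsub>M2\<^esub>) \<in> maps_hom \<Lambda> M0 zero_module (\<lambda>_. ()) M1 M2 f"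
      by (simp add: maps_hom_def M0_iff incl zero_hom[OF left_modules(6)])
    obtain v1 v2 where v: "(v1, v2) \<in> maps_hom \<Lambda> M0 zero_module (\<lambda>_. ()) E1 E2 h"
      "\<And>x. x \<in> carrier M0 \<Longrightarrow> p1 (v1 x) = x"
    proof (rule maps_right_almost_split_lift[OF ras E M X u])
      assume zero: "\<And>y. y \<in> carrier M2 \<Longrightarrow> \<zero>\<^bsub>M2\<^esub> = y"
      have "f \<zero>\<^bsub>M1\<^esub> = y" if "y \<in> carrier M2" for y using zero[OF that] f0 by simp
      with f zero_hom[OF left_modules(3)] have "splittable_epi \<Lambda> M1 M2 f"
        by (rule splittable_epiI)
      then show False using assms(10) by simp
    qed blast
    note v1 = maps_homD(1)[OF v(1)] and v2 = maps_homD(2)[OF v(1)] and hv = maps_homD(3)[OF v(1)]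
    have "v2 () = \<zero>\<^bsub>E2\<^esub>"
      using lmod_hom_zero[OF fg_module_imp_left_module[OF zero_fg] left_modules(5) v2]
      by (simp add: zero_module_def)
    then have "v1 \<in> lmod_hom \<Lambda> M0 E0"
      using lmod_homD[OF v1] hv
      by (intro lmod_homI) (simp_all add: E0_iff, simp_all add: E0_def ker_module_def)
    then show ?thesis using v(2) by blast
  qed
  then obtain s0 where s0: "s0 \<in> lmod_hom \<Lambda> M0 E0" "\<And>x. x \<in> carrier M0 \<Longrightarrow> p1 (s0 x) = x"
    by blast
  have "carrier M0 \<subseteq> p1 ` carrier E0"
  proof
    fix x assume x: "x \<in> carrier M0"
    show "x \<in> p1 ` carrier E0"
      using s0(2)[OF x] lmod_hom_closed[OF s0(1) x] by (intro image_eqI[of x p1 "s0 x"]) simp_all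
  qed
  then have exact0: "short_exact \<Lambda> N0 j1 E0 p1 M0"
    using short_exact_kernels fg0 unfolding N0_def E0_def M0_def by blast
  then have epi0: "splittable_epi \<Lambda> E0 M0 p1"
    using s0 by (intro splittable_epiI) (simp_all add: short_exact_def)

  have N3: "fg_module \<Lambda> N3"
    unfolding N3_def coker_module_def using fg_modules(4) images(1) by (rule fg_quotient_module)
  \<comment> \<open>Dually, the projection \<open>(N1, N2, g) \<rightarrow> (0, N3, 0)\<close> is a splittable monomorphism only if \<open>N1\<close> is
    zero, in which case \<open>g\<close> is a splittable monomorphism. An extension of it to \<open>(E1, E2, h)\<close>
    vanishes on the image of \<open>h\<close> and induces a retraction of \<open>j3\<close>.\<close>
  have "\<exists>t \<in> lmod_hom \<Lambda> E3 N3. \<forall>C \<in> carrier N3. t (j3 C) = C"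
  proof -
    let ?q = "\<lambda>x. g ` carrier N1 +>\<^bsub>N2\<^esub> x"
    have N3_lm: "left_module \<Lambda> N3" using N3 by (rule fg_module_imp_left_module)
    have q: "?q \<in> lmod_hom \<Lambda> N2 N3"
      unfolding N3_def coker_module_def
      using left_modules(4) images(1) by (rule quotient_projection_hom)
    have qg: "?q (g x) = \<zero>\<^bsub>N3\<^esub>" if "x \<in> carrier N1" for x
    proof -
      have "g x \<ominus>\<^bsub>N2\<^esub> \<zero>\<^bsub>N2\<^esub> \<in> g ` carrier N1"
        using that images(1) by (intro N2.submodule_minus submodule_zero[OF images(1)]) auto
      then have "?q (g x) = ?q \<zero>\<^bsub>N2\<^esub>"
        using that N2.coset_eq_iff[OF images(1), of "g x" "\<zero>\<^bsub>N2\<^esub>"] by simp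
      then show ?thesis
        by (simp add: N3_def coker_module_def quotient_zero[OF left_modules(4) images(1)])
    qed
    have X: "maps_obj \<Lambda> zero_module N3 (\<lambda>_. \<zero>\<^bsub>N3\<^esub>)"
      by (simp add: maps_obj_def zero_fg N3 zero_hom[OF N3_lm])
    have u: "(\<lambda>_. (), ?q) \<in> maps_hom \<Lambda> N1 N2 g zero_module N3 (\<lambda>_. \<zero>\<^bsub>N3\<^esub>)"
      by (simp add: maps_hom_def hom_to_zero_module q qg)
    obtain v1 v2 where v: "(v1, v2) \<in> maps_hom \<Lambda> E1 E2 h zero_module N3 (\<lambda>_. \<zero>\<^bsub>N3\<^esub>)"
      "\<And>x. x \<in> carrier N2 \<Longrightarrow> v2 (j2 x) = ?q x"
    proof (rule maps_left_almost_split_lift[OF las N E X j_hom u])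
      fix t1 :: "unit \<Rightarrow> 'n1"
      assume t1: "\<And>x. x \<in> carrier N1 \<Longrightarrow> t1 () = x"
      have "\<zero>\<^bsub>N1\<^esub> = x" if "x \<in> carrier N1" for x
        using t1[OF that] t1[OF N1.M.zero_closed] by simp
      with g zero_hom[OF left_modules(1)] have "splittable_mono \<Lambda> N1 N2 g"
        by (rule splittable_monoI)
      then show False using assms(9) by simp
    qed blast
    have v2: "v2 \<in> lmod_hom \<Lambda> E2 N3" "\<And>y. y \<in> h ` carrier E1 \<Longrightarrow> v2 y = \<zero>\<^bsub>N3\<^esub>"
      using maps_homD[OF v(1)] by auto
    obtain t where t: "t \<in> lmod_hom \<Lambda> E3 N3"
      "\<And>x. x \<in> carrier E2 \<Longrightarrow> t (h ` carrier E1 +>\<^bsub>E2\<^esub> x) = v2 x"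
      using quotient_hom_lift[OF left_modules(5) N3_lm images(2) v2]
      unfolding E3_def coker_module_def by metis
    have "t (j3 C) = C" if "C \<in> carrier N3" for C
    proof -
      have "C \<in> ?q ` carrier N2"
        using that unfolding N3_def coker_module_def quotient_carrier[OF left_modules(4) images(1)] .
      then obtain x where x: "x \<in> carrier N2" "C = ?q x" by blast
      then show ?thesis by (simp add: j3_def coker_map_j2 t(2) v(2))
    qed
    then show ?thesis using t(1) by blast
  qed
  then obtain t3 where t3: "t3 \<in> lmod_hom \<Lambda> E3 N3" "\<And>C. C \<in> carrier N3 \<Longrightarrow> t3 (j3 C) = C"
    by blast
  have inj3: "inj_on j3 (carrier N3)"
    using t3(2) by (rule inj_on_inverseI)
  then have exact3: "short_exact \<Lambda> N3 j3 E3 p3 M3"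
    unfolding N3_def E3_def M3_def j3_def p3_def by (rule short_exact_cokernels)
  then have "splittable_mono \<Lambda> N3 E3 j3"
    using t3 by (intro splittable_monoI) (simp_all add: short_exact_def)
  with exact3 have epi3: "splittable_epi \<Lambda> E3 M3 p3"
    by (rule short_exact_retraction_imp_section)

  show ?thesis
    using exact0 epi0 row1 epi1 row2 epi2 exact3 epi3 inj3
    by (simp add: split_short_exact_def) (simp add: short_exact_def)
qed

end
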